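(* Let $X$ be a Tychonoff space. Then the following assertions are equivalent: (i) $B_1(X)$ is a Montel space; (ii) $B_1(X)$ is a semi-Montel space; (iii) $B_1(X)$ is a reflexive space; (iv) $B_1(X)$ is a semi-reflexive space; (v) $B_1(X)$ is a complete space; (vi) $B_1(X)$ is a quasi-complete space; (vii) $B_1(X)=\mathbb{R}^X$; (viii) $X$ is a $Q_f$-space.
   Context: All topological spaces are Tychonoff. $C(X)$ is the set of continuous real-valued functions on $X$. $B_1(X)$ is the space of Baire-one functions on $X$, i.e. all functions $f:X\to\mathbb{R}$ that are pointwise limits of sequences from $C(X)$; it is a real locally convex space with the pointwise topology (the subspace topology inherited from the product $\mathbb{R}^X$). A subset $A\subseteq X$ is a zero-set if $A=f^{-1}(0)$ for some $f\in C(X)$; a cozero-set is the complement of a zero-set. A $Zer_\sigma$-set is a countable union of zero-sets, a $Coz_\delta$-set is a countable intersection of cozero-sets, and a $CZ$-set is a set which is both a $Zer_\sigma$-set and a $Coz_\delta$-set. $X$ is a $Q_f$-space if each subset of $X$ is a $CZ$-set. For a Hausdorff locally convex space $E$, $E'$ is its topological dual, $E'_\beta$ is $E'$ with the strong topology $\beta(E',E)$, $E''=(E'_\beta)'_\beta$, and $\psi_E:E\to E''$ is the canonical evaluation map $\langle\psi_E(x),\chi\rangle=\langle\chi,x\rangle$. $E$ is: semi-reflexive if $\psi_E$ is surjective; reflexive if $\psi_E$ is a topological isomorphism; semi-Montel if every bounded subset of $E$ is relatively compact; Montel if it is semi-Montel and reflexive; complete if each Cauchy net in $E$ converges; quasi-complete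 if each closed bounded subset of $E$ is complete. *)

theory Defs
  imports "HOL-Analysis.Analysis" "HOL-Library.Function_Algebras"
begin

section \<open>Pointwise real vector space structure on function types\<close>

instantiation "fun" :: (type, scaleR) scaleR
begin

definition scaleR_fun_def: "c *\<^sub>R f = (\<lambda>x. c *\<^sub>R f x)"

instance ..

end

lemma scaleR_fun_apply [simp]: "(c *\<^sub>R f) x = c *\<^sub>R f x"
  by (simp add: scaleR_fun_def)

instance "fun" :: (type, real_vector) real_vector
  by standard (simp_all add: fun_eq_iff scaleR_add_right scaleR_add_left)

text \<open>
  Real-valued functions on a set \<open>A\<close> are represented by the functions on the whole type
  that vanish outside \<open>A\<close>; they form a linear subspace of the function type,
  which represents the full power \<open>\<real>\<^sup>A\<close>.
\<close>

definition zero_outside :: "'a set \<Rightarrow> ('a \<Rightarrow> real) set" where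
  "zero_outside A = {f. \<forall>x. x \<notin> A \<longrightarrow> f x = 0}"


section \<open>Topological vector spaces\<close>

text \<open>
  A real topological vector space is given by a topology \<open>T\<close> on a type of class
  \<^class>\<open>real_vector\<close> whose carrier \<open>topspace T\<close> is a linear subspace of that type.
\<close>

definition tvs_bounded :: "'v::real_vector topology \<Rightarrow> 'v set \<Rightarrow> bool" where
  "tvs_bounded T A \<longleftrightarrow> A \<subseteq> topspace T \<and>
     (\<forall>U. openin T U \<and> 0 \<in> U \<longrightarrow> (\<exists>r>0. \<forall>s\<ge>r. A \<subseteq> (*\<^sub>R) s ` U))"

definition linear_map_on :: "'v::real_vector set \<Rightarrow> ('v \<Rightarrow> 'w::real_vector) \<Rightarrow> bool" where
  "linear_map_on V f \<longleftrightarrow>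
     (\<forall>x\<in>V. \<forall>y\<in>V. f (x + y) = f x + f y) \<and> (\<forall>c. \<forall>x\<in>V. f (c *\<^sub>R x) = c *\<^sub>R f x)"

definition topological_isomorphism ::
  "'v::real_vector topology \<Rightarrow> 'w::real_vector topology \<Rightarrow> ('v \<Rightarrow> 'w) \<Rightarrow> bool" where
  "topological_isomorphism S T f \<longleftrightarrow> linear_map_on (topspace S) f \<and> homeomorphic_map S T f"


subsection \<open>Strong dual and bidual\<close>

definition dual :: "'v::real_vector topology \<Rightarrow> ('v \<Rightarrow> real) set" where
  "dual T = {\<phi> \<in> zero_outside (topspace T).
     linear_map_on (topspace T) \<phi> \<and> continuous_map T euclideanreal \<phi>}"

definition polar :: "'v::real_vector topology \<Rightarrow> 'v set \<Rightarrow> ('v \<Rightarrow> real) set" where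
  "polar T A = {\<phi> \<in> dual T. \<forall>x\<in>A. \<bar>\<phi> x\<bar> \<le> 1}"

text \<open>
  The strong topology \<open>\<beta>(E',E)\<close> has the polars of the bounded subsets of \<open>E\<close> as a base
  of neighbourhoods of zero.
\<close>

definition strong_dual :: "'v::real_vector topology \<Rightarrow> ('v \<Rightarrow> real) topology" where
  "strong_dual T = topology (\<lambda>U. U \<subseteq> dual T \<and>
     (\<forall>\<phi>\<in>U. \<exists>A. tvs_bounded T A \<and> (\<forall>\<omega>\<in>dual T. \<omega> - \<phi> \<in> polar T A \<longrightarrow> \<omega> \<in> U)))"

lemma tvs_bounded_Un:
  assumes "tvs_bounded T A" "tvs_bounded T B"
  shows "tvs_bounded T (A \<union> B)"
  unfolding tvs_bounded_def
proof (intro conjI allI impI)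
  show "A \<union> B \<subseteq> topspace T"
    using assms by (simp add: tvs_bounded_def)
  fix U assume U: "openin T U \<and> 0 \<in> U"
  obtain r where "r > 0" "\<forall>s\<ge>r. A \<subseteq> (*\<^sub>R) s ` U"
    using assms(1) U unfolding tvs_bounded_def by blast
  moreover obtain q where "q > 0" "\<forall>s\<ge>q. B \<subseteq> (*\<^sub>R) s ` U"
    using assms(2) U unfolding tvs_bounded_def by blast
  ultimately show "\<exists>r>0. \<forall>s\<ge>r. A \<union> B \<subseteq> (*\<^sub>R) s ` U"
    by (intro exI[of _ "max r q"]) simp
qed

lemma tvs_bounded_empty: "tvs_bounded T {}"
  unfolding tvs_bounded_def by (auto intro: exI[of _ "1::real"])

lemma openin_strong_dual:
  "openin (strong_dual T) U \<longleftrightarrow> U \<subseteq> dual T \<and>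
     (\<forall>\<phi>\<in>U. \<exists>A. tvs_bounded T A \<and> (\<forall>\<omega>\<in>dual T. \<omega> - \<phi> \<in> polar T A \<longrightarrow> \<omega> \<in> U))"
proof -
  define P where "P U \<longleftrightarrow> U \<subseteq> dual T \<and>
     (\<forall>\<phi>\<in>U. \<exists>A. tvs_bounded T A \<and> (\<forall>\<omega>\<in>dual T. \<omega> - \<phi> \<in> polar T A \<longrightarrow> \<omega> \<in> U))" for U
  have "P (S \<inter> S')" if S: "P S" "P S'" for S S'
    unfolding P_def
  proof (intro conjI ballI)
    show "S \<inter> S' \<subseteq> dual T"
      using S by (auto simp: P_def)
    fix \<phi> assume \<phi>: "\<phi> \<in> S \<inter> S'"
    obtain A where A: "tvs_bounded T A" "\<forall>\<omega>\<in>dual T. \<omega> - \<phi> \<in> polar T A \<longrightarrow> \<omega> \<in> S"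
      using S(1) \<phi> unfolding P_def by blast
    obtain B where B: "tvs_bounded T B" "\<forall>\<omega>\<in>dual T. \<omega> - \<phi> \<in> polar T B \<longrightarrow> \<omega> \<in> S'"
      using S(2) \<phi> unfolding P_def by blast
    have "polar T (A \<union> B) \<subseteq> polar T A \<inter> polar T B"
      by (auto simp: polar_def)
    then show "\<exists>C. tvs_bounded T C \<and> (\<forall>\<omega>\<in>dual T. \<omega> - \<phi> \<in> polar T C \<longrightarrow> \<omega> \<in> S \<inter> S')"
      using A B tvs_bounded_Un[OF A(1) B(1)] by (intro exI[of _ "A \<union> B"]) blast
  qed
  moreover have "P (\<Union>K)" if "\<forall>S\<in>K. P S" for K
    unfolding P_def
  proof (intro conjI ballI)
    show "\<Union>K \<subseteq> dual T"
      using that by (auto simp: P_def)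
    fix \<phi> assume "\<phi> \<in> \<Union>K"
    then obtain S where S: "S \<in> K" "\<phi> \<in> S"
      by blast
    have "P S"
      using that S(1) by blast
    then obtain A where "tvs_bounded T A" "\<forall>\<omega>\<in>dual T. \<omega> - \<phi> \<in> polar T A \<longrightarrow> \<omega> \<in> S"
      using S(2) unfolding P_def by blast
    then show "\<exists>A. tvs_bounded T A \<and> (\<forall>\<omega>\<in>dual T. \<omega> - \<phi> \<in> polar T A \<longrightarrow> \<omega> \<in> \<Union>K)"
      using S by blast
  qed
  ultimately have "istopology P"
    unfolding istopology_def by blast
  moreover have "strong_dual T = topology P"
    unfolding strong_dual_def P_def ..
  ultimately have "openin (strong_dual T) = P"
    by (simp add: topology_inverse')
  then show ?thesis
    by (simp add: P_def)
qed

lemma topspace_strong_dual [simp]: "topspace (strong_dual T) = dual T"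
proof
  show "topspace (strong_dual T) \<subseteq> dual T"
    using openin_topspace[of "strong_dual T"] unfolding openin_strong_dual by blast
  have "openin (strong_dual T) (dual T)"
    unfolding openin_strong_dual using tvs_bounded_empty by blast
  then show "dual T \<subseteq> topspace (strong_dual T)"
    by (rule openin_subset)
qed

abbreviation bidual :: "'v::real_vector topology \<Rightarrow> (('v \<Rightarrow> real) \<Rightarrow> real) topology" where
  "bidual T \<equiv> strong_dual (strong_dual T)"

definition canonical_embedding :: "'v::real_vector topology \<Rightarrow> 'v \<Rightarrow> ('v \<Rightarrow> real) \<Rightarrow> real" where
  "canonical_embedding T x = (\<lambda>\<phi>. if \<phi> \<in> dual T then \<phi> x else 0)"


subsection \<open>Reflexivity and Montel properties\<close>

definition semi_reflexive :: "'v::real_vector topology \<Rightarrow> bool" where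
  "semi_reflexive T \<longleftrightarrow> canonical_embedding T ` topspace T = topspace (bidual T)"

definition reflexive :: "'v::real_vector topology \<Rightarrow> bool" where
  "reflexive T \<longleftrightarrow> topological_isomorphism T (bidual T) (canonical_embedding T)"

definition semi_Montel :: "'v::real_vector topology \<Rightarrow> bool" where
  "semi_Montel T \<longleftrightarrow> (\<forall>A. tvs_bounded T A \<longrightarrow> compactin T (T closure_of A))"

definition Montel :: "'v::real_vector topology \<Rightarrow> bool" where
  "Montel T \<longleftrightarrow> semi_Montel T \<and> reflexive T"


subsection \<open>Nets and completeness\<close>

definition directed_index :: "'i set \<Rightarrow> ('i \<Rightarrow> 'i \<Rightarrow> bool) \<Rightarrow> bool" where
  "directed_index I le \<longleftrightarrow> I \<noteq> {} \<and> reflp_on I le \<and> transp_on I le \<and>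
     (\<forall>i\<in>I. \<forall>j\<in>I. \<exists>k\<in>I. le i k \<and> le j k)"

definition Cauchy_net ::
  "'v::real_vector topology \<Rightarrow> 'i set \<Rightarrow> ('i \<Rightarrow> 'i \<Rightarrow> bool) \<Rightarrow> ('i \<Rightarrow> 'v) \<Rightarrow> bool" where
  "Cauchy_net T I le x \<longleftrightarrow> (\<forall>U. openin T U \<and> 0 \<in> U \<longrightarrow>
     (\<exists>i\<in>I. \<forall>j\<in>I. \<forall>k\<in>I. le i j \<and> le i k \<longrightarrow> x j - x k \<in> U))"

definition net_converges ::
  "'v topology \<Rightarrow> 'i set \<Rightarrow> ('i \<Rightarrow> 'i \<Rightarrow> bool) \<Rightarrow> ('i \<Rightarrow> 'v) \<Rightarrow> 'v \<Rightarrow> bool" where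
  "net_converges T I le x l \<longleftrightarrow> l \<in> topspace T \<and> (\<forall>U. openin T U \<and> l \<in> U \<longrightarrow>
     (\<exists>i\<in>I. \<forall>j\<in>I. le i j \<longrightarrow> x j \<in> U))"

text \<open>
  A definition cannot quantify over the type of the index set. The index type \<open>'v set \<times> 'v\<close>
  is large enough: by lemma \<open>complete_set_any_index_type\<close> below, in a complete set
  the Cauchy nets over every index type converge.
\<close>

definition complete_set :: "'v::real_vector topology \<Rightarrow> 'v set \<Rightarrow> bool" where
  "complete_set T A \<longleftrightarrow> (\<forall>(I :: ('v set \<times> 'v) set) le x.
     directed_index I le \<and> x ` I \<subseteq> A \<and> Cauchy_net T I le x \<longrightarrow> (\<exists>l\<in>A. net_converges T I le x l))"

definition complete_space :: "'v::real_vector topology \<Rightarrow> bool" where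
  "complete_space T \<longleftrightarrow> complete_set T (topspace T)"

definition quasi_complete :: "'v::real_vector topology \<Rightarrow> bool" where
  "quasi_complete T \<longleftrightarrow> (\<forall>A. closedin T A \<and> tvs_bounded T A \<longrightarrow> complete_set T A)"

lemma complete_set_any_index_type:
  fixes I :: "'i set" and x :: "'i \<Rightarrow> 'v::real_vector"
  assumes A: "complete_set T A" and dir: "directed_index I le"
    and xA: "x ` I \<subseteq> A" and Cau: "Cauchy_net T I le x"
  shows "\<exists>l\<in>A. net_converges T I le x l"
proof -
  define tail where "tail i = x ` {j\<in>I. le i j}" for i
  define J where "J = {p :: 'v set \<times> 'v. \<exists>i\<in>I. fst p = tail i \<and> snd p \<in> tail i}"
  define le' where "le' p q \<longleftrightarrow> fst q \<subseteq> fst p" for p q :: "'v set \<times> 'v"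
  have refl: "le i i" if "i \<in> I" for i
    using dir that by (auto simp: directed_index_def reflp_on_def)
  have trans: "le i k" if "le i j" "le j k" "i \<in> I" "j \<in> I" "k \<in> I" for i j k
    using dir that unfolding directed_index_def transp_on_def by blast
  have dirD: "\<exists>k\<in>I. le i k \<and> le j k" if "i \<in> I" "j \<in> I" for i j
    using dir that unfolding directed_index_def by blast
  have mono: "tail j \<subseteq> tail i" if "le i j" "i \<in> I" "j \<in> I" for i j
    unfolding tail_def using trans that by blast
  have in_J: "(tail i, x i) \<in> J" if "i \<in> I" for i
    unfolding J_def tail_def using refl that by auto
  have "directed_index J le'"
    unfolding directed_index_def
  proof (intro conjI ballI)
    show "J \<noteq> {}"
      using dir in_J unfolding directed_index_def by blast
    show "reflp_on J le'" "transp_on J le'"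
      by (auto simp: reflp_on_def transp_on_def le'_def)
    fix p q assume "p \<in> J" "q \<in> J"
    then obtain i j where ij: "i \<in> I" "fst p = tail i" "j \<in> I" "fst q = tail j"
      unfolding J_def by blast
    obtain k where k: "k \<in> I" "le i k" "le j k"
      using dirD ij by blast
    have "le' p (tail k, x k)" "le' q (tail k, x k)"
      unfolding le'_def using mono k ij by simp_all
    then show "\<exists>k\<in>J. le' p k \<and> le' q k"
      using in_J[OF k(1)] by blast
  qed
  moreover have "snd ` J \<subseteq> A"
    using xA unfolding J_def tail_def by auto
  moreover have "Cauchy_net T J le' snd"
    unfolding Cauchy_net_def
  proof (intro allI impI)
    fix U assume "openin T U \<and> 0 \<in> U"
    then obtain i where i: "i \<in> I" "\<forall>j\<in>I. \<forall>k\<in>I. le i j \<and> le i k \<longrightarrow> x j - x k \<in> U"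
      using Cau unfolding Cauchy_net_def by blast
    have "snd p - snd q \<in> U" if "p \<in> J" "q \<in> J" "le' (tail i, x i) p" "le' (tail i, x i) q" for p q
    proof -
      have "snd p \<in> tail i" "snd q \<in> tail i"
        using that unfolding J_def le'_def by auto
      then show ?thesis
        using i(2) unfolding tail_def by auto
    qed
    then show "\<exists>i\<in>J. \<forall>j\<in>J. \<forall>k\<in>J. le' i j \<and> le' i k \<longrightarrow> snd j - snd k \<in> U"
      using in_J[OF i(1)] by blast
  qed
  ultimately obtain l where l: "l \<in> A" "net_converges T J le' snd l"
    using A unfolding complete_set_def by blast
  have "net_converges T I le x l"
    unfolding net_converges_def
  proof (intro conjI allI impI)
    show "l \<in> topspace T"
      using l by (simp add: net_converges_def)
    fix U assume "openin T U \<and> l \<in> U"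
    then obtain p where p: "p \<in> J" "\<forall>q\<in>J. le' p q \<longrightarrow> snd q \<in> U"
      using l(2) unfolding net_converges_def by blast
    then obtain i where i: "i \<in> I" "fst p = tail i"
      unfolding J_def by blast
    have "x j \<in> U" if "j \<in> I" "le i j" for j
    proof -
      have "le' p (tail j, x j)"
        unfolding le'_def using mono i that by simp
      then show ?thesis
        using p(2) in_J[OF that(1)] by fastforce
    qed
    then show "\<exists>i\<in>I. \<forall>j\<in>I. le i j \<longrightarrow> x j \<in> U"
      using i(1) by blast
  qed
  then show ?thesis
    using l(1) by blast
qed


section \<open>Baire-one functions and descriptive classes of sets\<close>

definition Tychonoff_space :: "'a topology \<Rightarrow> bool" where
  "Tychonoff_space X \<longleftrightarrow> completely_regular_space X \<and> Hausdorff_space X"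

definition cont_functions :: "'a topology \<Rightarrow> ('a \<Rightarrow> real) set" where
  "cont_functions X = {f \<in> zero_outside (topspace X). continuous_map X euclideanreal f}"

definition Baire_one :: "'a topology \<Rightarrow> ('a \<Rightarrow> real) set" where
  "Baire_one X = {f \<in> zero_outside (topspace X). \<exists>g :: nat \<Rightarrow> 'a \<Rightarrow> real.
     (\<forall>n. g n \<in> cont_functions X) \<and> (\<forall>x\<in>topspace X. (\<lambda>n. g n x) \<longlonglongrightarrow> f x)}"

text \<open>
  The product \<open>powertop_real A\<close> lives on functions that are undefined outside \<open>A\<close>;
  restriction identifies \<open>zero_outside A\<close> with it, and the pullback along restriction
  is the topology of pointwise convergence on \<open>A\<close>.
\<close>

definition Baire_one_space :: "'a topology \<Rightarrow> ('a \<Rightarrow> real) topology" where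
  "Baire_one_space X =
     pullback_topology (Baire_one X) (\<lambda>f. restrict f (topspace X)) (powertop_real (topspace X))"

lemma topspace_Baire_one_space [simp]: "topspace (Baire_one_space X) = Baire_one X"
  by (auto simp: Baire_one_space_def topspace_pullback_topology)

lemma subspace_Baire_one: "subspace (Baire_one X)"
  unfolding subspace_def
proof (intro conjI ballI allI)
  show "0 \<in> Baire_one X"
    unfolding Baire_one_def cont_functions_def zero_outside_def
    by (auto intro!: exI[of _ "\<lambda>_ _. 0"])
next
  fix f h assume "f \<in> Baire_one X" "h \<in> Baire_one X"
  then obtain g k where
    "f \<in> zero_outside (topspace X)" "h \<in> zero_outside (topspace X)"
    "\<forall>n. g n \<in> cont_functions X" "\<forall>x\<in>topspace X. (\<lambda>n. g n x) \<longlonglongrightarrow> f x"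
    "\<forall>n. k n \<in> cont_functions X" "\<forall>x\<in>topspace X. (\<lambda>n. k n x) \<longlonglongrightarrow> h x"
    unfolding Baire_one_def by blast
  then show "f + h \<in> Baire_one X"
    unfolding Baire_one_def cont_functions_def zero_outside_def
    by (auto intro!: exI[of _ "\<lambda>n x. g n x + k n x"] tendsto_add continuous_map_add)
next
  fix c f assume "f \<in> Baire_one X"
  then obtain g where
    "f \<in> zero_outside (topspace X)"
    "\<forall>n. g n \<in> cont_functions X" "\<forall>x\<in>topspace X. (\<lambda>n. g n x) \<longlonglongrightarrow> f x"
    unfolding Baire_one_def by blast
  then show "c *\<^sub>R f \<in> Baire_one X"
    unfolding Baire_one_def cont_functions_def zero_outside_def
    by (auto intro!: exI[of _ "\<lambda>n x. c * g n x"] tendsto_mult_left continuous_map_real_mult_left)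
qed

definition zero_set :: "'a topology \<Rightarrow> 'a set \<Rightarrow> bool" where
  "zero_set X A \<longleftrightarrow> (\<exists>f\<in>cont_functions X. A = {x \<in> topspace X. f x = 0})"

definition cozero_set :: "'a topology \<Rightarrow> 'a set \<Rightarrow> bool" where
  "cozero_set X A \<longleftrightarrow> (\<exists>Z. zero_set X Z \<and> A = topspace X - Z)"

definition Zer_sigma_set :: "'a topology \<Rightarrow> 'a set \<Rightarrow> bool" where
  "Zer_sigma_set X = countable union_of zero_set X"

definition Coz_delta_set :: "'a topology \<Rightarrow> 'a set \<Rightarrow> bool" where
  "Coz_delta_set X = (countable intersection_of cozero_set X) relative_to topspace X"

definition CZ_set :: "'a topology \<Rightarrow> 'a set \<Rightarrow> bool" where
  "CZ_set X A \<longleftrightarrow> Zer_sigma_set X A \<and> Coz_delta_set X A"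

definition Qf_space :: "'a topology \<Rightarrow> bool" where
  "Qf_space X \<longleftrightarrow> (\<forall>A. A \<subseteq> topspace X \<longrightarrow> CZ_set X A)"

end

theory Submission
  imports Defs
begin

text \<open>
  \<open>B\<^sub>1(X)\<close> is a dense subspace of \<open>\<real>\<^sup>X\<close>, and in fact every \<open>f\<close> with
  \<open>\<bar>f\<bar> \<le> 1\<close> agrees on any finite set with a continuous function of absolute value at
  most \<open>1\<close>. So \<open>f\<close> lies in the closure of the bounded closed set
  \<open>B = {g \<in> B\<^sub>1(X). \<bar>g\<bar> \<le> 1}\<close>: if \<open>B\<close> is compact or complete, then \<open>f\<close> is
  Baire-one. If the space is semi-reflexive, then \<open>f\<close> is Baire-one because
  \<open>\<phi> \<mapsto> \<Sum>\<^sub>x a\<^sub>x f(x)\<close>, for \<open>\<phi> = \<Sum>\<^sub>x a\<^sub>x \<delta>\<^sub>x\<close>, is an element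
  of the bidual, being bounded by \<open>1\<close> on the polar of \<open>B\<close>. The case of unbounded \<open>f\<close> follows by
  composing with a homeomorphism of the line onto an open interval. Conversely \<open>\<real>\<^sup>X\<close>
  is complete, semi-Montel and reflexive.

  If every function is Baire-one, then the indicator of \<open>A\<close> is a limit of continuous
  \<open>g\<^sub>n\<close>, and \<open>A = \<Union>\<^sub>m \<Inter>\<^sub>n\<^sub>\<ge>\<^sub>m {g\<^sub>n \<ge> 1/2}\<close> is a countable union of zero-sets.
  Conversely, in a \<open>Q\<^sub>f\<close>-space every indicator is Baire-one, and the binary expansion of
  a function with values in \<open>[0, 1)\<close> exhibits it as a dominated series of indicators.
\<close>

section \<open>Duals, complete sets and nets of real numbers\<close>

lemma subspace_dual: "subspace (dual S)"
  unfolding subspace_def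
proof (intro conjI ballI allI)
  show "0 \<in> dual S"
    by (simp add: dual_def zero_outside_def linear_map_on_def zero_fun_def)
next
  fix \<phi> \<psi> assume "\<phi> \<in> dual S" "\<psi> \<in> dual S"
  then show "\<phi> + \<psi> \<in> dual S"
    by (auto simp: dual_def zero_outside_def linear_map_on_def plus_fun_def algebra_simps
        intro!: continuous_map_add)
next
  fix c \<phi> assume "\<phi> \<in> dual S"
  then show "c *\<^sub>R \<phi> \<in> dual S"
    by (auto simp: dual_def zero_outside_def linear_map_on_def scaleR_fun_def algebra_simps
        intro!: continuous_map_real_mult_left)
qed

text \<open>The limit supplied by \<open>B\<close> cannot lie outside \<open>A\<close>: the
  complement of \<open>A\<close> would then be an open neighbourhood of it that catches a member of
  the net. With \<open>B\<close> the whole space this yields quasi-completeness from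
  completeness.\<close>

lemma complete_set_closedin:
  assumes B: "complete_set T B" and A: "closedin T A" "A \<subseteq> B"
  shows "complete_set T A"
  unfolding complete_set_def
proof (intro allI impI, elim conjE)
  fix I :: "('a set \<times> 'a) set" and le x
  assume I: "directed_index I le" "x ` I \<subseteq> A" "Cauchy_net T I le x"
  then have "x ` I \<subseteq> B"
    using A(2) by blast
  then obtain l where l: "l \<in> B" "net_converges T I le x l"
    using B I(1,3) unfolding complete_set_def by blast
  have "l \<in> A"
  proof (rule ccontr)
    assume "l \<notin> A"
    then have "openin T (topspace T - A) \<and> l \<in> topspace T - A"
      using A(1) l(2) unfolding net_converges_def by blast
    then obtain i where i: "i \<in> I" "\<forall>j\<in>I. le i j \<longrightarrow> x j \<in> topspace T - A"
      using l(2)[unfolded net_converges_def, THEN conjunct2, rule_format, of "topspace T - A"] by blast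
    then have "le i i"
      using I(1) unfolding directed_index_def reflp_on_def by blast
    then show False
      using i I(2) by blast
  qed
  then show "\<exists>l\<in>A. net_converges T I le x l"
    using l(2) by blast
qed

lemma sum_fun_apply: "(\<Sum>x\<in>A. f x) y = (\<Sum>x\<in>A. f x y)"
  for f :: "'a \<Rightarrow> 'b \<Rightarrow> 'c::comm_monoid_add"
  by (induction A rule: infinite_finite_induct) auto

lemma directed_index_finite_upper_bound:
  assumes "directed_index I le" "finite S" "S \<subseteq> I"
  shows "\<exists>k\<in>I. \<forall>i\<in>S. le i k"
  using assms(2,3)
proof (induction S rule: finite_induct)
  case empty
  then show ?case
    using assms(1) by (auto simp: directed_index_def)
next
  case (insert j S)
  then obtain k where k: "k \<in> I" "\<forall>i\<in>S. le i k"
    by auto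
  obtain m where m: "m \<in> I" "le j m" "le k m"
    using assms(1) k(1) insert.prems unfolding directed_index_def by blast
  have "le i m" if "i \<in> S" for i
    using assms(1) that insert.prems k m unfolding directed_index_def transp_on_def
    by (meson insert_subset subsetD)
  then show ?case
    using m by blast
qed

text \<open>The limit is the limit inferior of the net, obtained as the supremum of the set
  \<open>S\<close> of its eventual lower bounds; no sequence has to be extracted from the
  net.\<close>

lemma real_Cauchy_net_converges:
  fixes y :: "'i \<Rightarrow> real"
  assumes dir: "directed_index I le"
    and Cau: "\<And>e. e > 0 \<Longrightarrow> \<exists>i\<in>I. \<forall>j\<in>I. \<forall>k\<in>I. le i j \<and> le i k \<longrightarrow> \<bar>y j - y k\<bar> < e"
  shows "\<exists>L. \<forall>e>0. \<exists>i\<in>I. \<forall>j\<in>I. le i j \<longrightarrow> \<bar>y j - L\<bar> < e"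
proof -
  have refl: "le i i" if "i \<in> I" for i
    using dir that by (auto simp: directed_index_def reflp_on_def)
  define S where "S = {a. \<exists>i\<in>I. \<forall>j\<in>I. le i j \<longrightarrow> a \<le> y j}"
  \<comment> \<open>An index beyond which the net varies by less than \<open>e\<close> traps
    \<open>Sup S\<close> within \<open>e\<close> of \<open>y i\<close>; the first half also shows
    that \<open>S\<close> is nonempty, the second that it is bounded above.\<close>
  have near: "y i - e \<in> S \<and> (\<forall>a\<in>S. a \<le> y i + e)"
    if i: "i \<in> I" "\<forall>j\<in>I. \<forall>k\<in>I. le i j \<and> le i k \<longrightarrow> \<bar>y j - y k\<bar> < e" for i e
  proof (intro conjI ballI)
    have close: "\<bar>y i - y k\<bar> < e" if "k \<in> I" "le i k" for k
      using i refl that by blast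
    then show "y i - e \<in> S"
      unfolding S_def using i(1) by (force simp: abs_less_iff)
    fix a assume "a \<in> S"
    then obtain j where j: "j \<in> I" "\<And>k. k \<in> I \<Longrightarrow> le j k \<Longrightarrow> a \<le> y k"
      unfolding S_def by blast
    obtain k where "k \<in> I" "le i k" "le j k"
      using dir i(1) j(1) unfolding directed_index_def by blast
    then show "a \<le> y i + e"
      using close[of k] j(2)[of k] by linarith
  qed
  have "\<exists>i\<in>I. \<forall>j\<in>I. le i j \<longrightarrow> \<bar>y j - Sup S\<bar> < e" if "e > 0" for e
  proof -
    obtain i where i: "i \<in> I" "\<forall>j\<in>I. \<forall>k\<in>I. le i j \<and> le i k \<longrightarrow> \<bar>y j - y k\<bar> < e / 2"
      using Cau[OF half_gt_zero[OF \<open>e > 0\<close>]] by blast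
    have "y i - e / 2 \<le> Sup S"
      using near[OF i] by (intro cSup_upper) (auto simp: bdd_above_def)
    moreover have "Sup S \<le> y i + e / 2"
      using near[OF i] by (intro cSup_least) auto
    moreover have "\<bar>y i - y j\<bar> < e / 2" if "j \<in> I" "le i j" for j
      using i refl that by blast
    ultimately have "\<bar>y j - Sup S\<bar> < e" if "j \<in> I" "le i j" for j
      using that by (smt (verit) field_sum_of_halves)
    then show ?thesis
      using i(1) by blast
  qed
  then show ?thesis
    by blast
qed

section \<open>Function spaces with the pointwise topology\<close>

text \<open>Keeping \<open>E\<close> abstract lets one topology \<open>T\<close> serve both for
  \<open>Baire_one X\<close> as it is given and for the full power once the two are known to
  coincide.\<close>

locale function_space =
  fixes Y :: "'a set" and E :: "('a \<Rightarrow> real) set"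
  assumes subspace_E: "subspace E" and E_subset: "E \<subseteq> zero_outside Y"
begin

definition T :: "('a \<Rightarrow> real) topology" where
  "T = pullback_topology E (\<lambda>f. restrict f Y) (powertop_real Y)"

lemma topspace_T [simp]: "topspace T = E"
  by (auto simp: T_def topspace_pullback_topology)

lemma E_add: "f \<in> E \<Longrightarrow> g \<in> E \<Longrightarrow> f + g \<in> E"
  and E_diff: "f \<in> E \<Longrightarrow> g \<in> E \<Longrightarrow> f - g \<in> E"
  and E_scale: "f \<in> E \<Longrightarrow> c *\<^sub>R f \<in> E"
  and E_zero: "0 \<in> E"
  using subspace_E by (simp_all add: subspace_add subspace_diff subspace_scale subspace_0)

lemma openin_T_basic:
  assumes "finite F" "F \<subseteq> Y"
  shows "openin T {g\<in>E. \<forall>x\<in>F. \<bar>g x - f x\<bar> < e}"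
proof -
  \<comment> \<open>The factor is a ball for \<open>x\<close> in \<open>F\<close> and the whole line
    elsewhere, so only finitely many factors are proper.\<close>
  let ?W = "\<lambda>x. {t. x \<in> F \<longrightarrow> t \<in> ball (f x) e}"
  have "open (?W x)" for x
    by (cases "x \<in> F") (simp_all del: mem_ball)
  moreover have "{x\<in>Y. ?W x \<noteq> UNIV} \<subseteq> F"
    by auto
  ultimately have "openin (powertop_real Y) (PiE Y ?W)"
    using assms(1) by (auto simp: openin_PiE_gen simp del: mem_ball intro: finite_subset)
  moreover have "{g\<in>E. \<forall>x\<in>F. \<bar>g x - f x\<bar> < e} = (\<lambda>f. restrict f Y) -` (PiE Y ?W) \<inter> E"
    using assms(2) by (auto simp: PiE_iff dist_real_def abs_minus_commute)
  ultimately show ?thesis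
    unfolding T_def openin_pullback_topology by blast
qed

text \<open>A basic product neighbourhood restricts finitely many coordinates, so one radius, the
  minimum over these, suffices. Most later arguments reach the topology only through this
  criterion.\<close>

lemma openin_T:
  "openin T U \<longleftrightarrow> U \<subseteq> E \<and> (\<forall>f\<in>U. \<exists>F e. finite F \<and> F \<subseteq> Y \<and> 0 < e \<and>
     (\<forall>g\<in>E. (\<forall>x\<in>F. \<bar>g x - f x\<bar> < e) \<longrightarrow> g \<in> U))"
proof (intro iffI conjI ballI)
  assume U: "openin T U"
  then show "U \<subseteq> E"
    using openin_subset by fastforce
  fix f assume "f \<in> U"
  obtain V where V: "openin (powertop_real Y) V" "U = (\<lambda>f. restrict f Y) -` V \<inter> E"
    using U unfolding T_def openin_pullback_topology by blast
  obtain W where W: "finite {i\<in>Y. W i \<noteq> UNIV}" "\<forall>i\<in>Y. open (W i)"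
      "restrict f Y \<in> PiE Y W" "PiE Y W \<subseteq> V"
    using V \<open>f \<in> U\<close> unfolding openin_product_topology_alt by fastforce
  define F where "F = {i\<in>Y. W i \<noteq> UNIV}"
  have "\<exists>e>0. ball (f x) e \<subseteq> W x" if "x \<in> Y" for x
    using W(2,3) that by (intro open_contains_ball[THEN iffD1, rule_format]) (auto simp: PiE_iff)
  then obtain d where d: "d x > 0" "ball (f x) (d x) \<subseteq> W x" if "x \<in> Y" for x
    by metis
  \<comment> \<open>Inserting 1 keeps the minimum meaningful when \<open>F\<close> is empty.\<close>
  define e where "e = Min (insert 1 (d ` F))"
  have F: "finite F" "F \<subseteq> Y"
    using W(1) by (auto simp: F_def)
  have "e > 0" "\<And>x. x \<in> F \<Longrightarrow> e \<le> d x"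
    unfolding e_def using F d(1) by (auto simp: subset_iff)
  moreover have "g \<in> U" if g: "g \<in> E" "\<forall>x\<in>F. \<bar>g x - f x\<bar> < e" for g
  proof -
    have "g x \<in> W x" if "x \<in> Y" for x
    proof (cases "x \<in> F")
      case True
      then have "g x \<in> ball (f x) (d x)"
        using g(2) calculation(2)[OF True] by (force simp: dist_real_def abs_minus_commute)
      then show ?thesis
        using d(2) that by blast
    qed (use that in \<open>auto simp: F_def\<close>)
    then have "restrict g Y \<in> PiE Y W"
      by auto
    then show ?thesis
      using W(4) V(2) g(1) by blast
  qed
  ultimately show "\<exists>F e. finite F \<and> F \<subseteq> Y \<and> 0 < e \<and>
     (\<forall>g\<in>E. (\<forall>x\<in>F. \<bar>g x - f x\<bar> < e) \<longrightarrow> g \<in> U)"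
    using F by blast
next
  assume U: "U \<subseteq> E \<and> (\<forall>f\<in>U. \<exists>F e. finite F \<and> F \<subseteq> Y \<and> 0 < e \<and>
     (\<forall>g\<in>E. (\<forall>x\<in>F. \<bar>g x - f x\<bar> < e) \<longrightarrow> g \<in> U))"
  show "openin T U"
  proof (subst openin_subopen, rule ballI)
    fix f assume "f \<in> U"
    then obtain F e where Fe: "finite F" "F \<subseteq> Y" "0 < e"
       "\<forall>g\<in>E. (\<forall>x\<in>F. \<bar>g x - f x\<bar> < e) \<longrightarrow> g \<in> U"
      using U by meson
    then show "\<exists>V. openin T V \<and> f \<in> V \<and> V \<subseteq> U"
      using U \<open>f \<in> U\<close> by (intro exI[of _ "{g\<in>E. \<forall>x\<in>F. \<bar>g x - f x\<bar> < e}"])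
        (auto intro!: openin_T_basic)
  qed
qed

lemma closedin_T_point:
  assumes "x \<in> Y" "closed S"
  shows "closedin T {g\<in>E. g x \<in> S}"
  unfolding closedin_def
proof
  have "\<exists>e>0. \<forall>g\<in>E. \<bar>g x - f x\<bar> < e \<longrightarrow> g x \<notin> S" if fx: "f x \<notin> S" for f
  proof -
    have "open (- S)"
      using assms(2) by auto
    then obtain e where "e > 0" "ball (f x) e \<subseteq> - S"
      using openE[of "- S" "f x"] fx by (metis ComplI)
    then show ?thesis
      by (intro exI[of _ e]) (auto simp: subset_iff dist_real_def abs_minus_commute)
  qed
  then have "\<forall>f\<in>E - {g\<in>E. g x \<in> S}. \<exists>e>0. \<forall>g\<in>E. (\<forall>y\<in>{x}. \<bar>g y - f y\<bar> < e) \<longrightarrow> g \<in> E - {g\<in>E. g x \<in> S}"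
    by simp
  moreover have "finite {x}" "{x} \<subseteq> Y"
    using assms by auto
  ultimately show "openin T (topspace T - {g\<in>E. g x \<in> S})"
    unfolding openin_T topspace_T by (meson Diff_subset)
qed auto

text \<open>A neighbourhood of zero constrains finitely many points only, so the bounds at these
  points combine into one scaling factor; conversely the neighbourhood given by
  \<open>\<bar>g x\<bar> < 1\<close> reveals a bound at \<open>x\<close>.\<close>

lemma tvs_bounded_T:
  "tvs_bounded T A \<longleftrightarrow> A \<subseteq> E \<and> (\<forall>x\<in>Y. \<exists>M. \<forall>f\<in>A. \<bar>f x\<bar> \<le> M)"
proof (intro iffI conjI ballI)
  assume A: "tvs_bounded T A"
  then show "A \<subseteq> E"
    by (simp add: tvs_bounded_def)
  fix x assume "x \<in> Y"
  let ?U = "{g\<in>E. \<forall>y\<in>{x}. \<bar>g y - 0 y\<bar> < 1}"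
  have "openin T ?U"
    using \<open>x \<in> Y\<close> by (intro openin_T_basic) auto
  moreover have "0 \<in> ?U"
    using E_zero by simp
  ultimately obtain r where r: "r > 0" "\<forall>s\<ge>r. A \<subseteq> (*\<^sub>R) s ` ?U"
    using A unfolding tvs_bounded_def by meson
  have "\<bar>f x\<bar> \<le> r" if "f \<in> A" for f
  proof -
    have "f \<in> (*\<^sub>R) r ` ?U"
      using r(2) that by blast
    then obtain g where "f = r *\<^sub>R g" "\<bar>g x\<bar> < 1"
      by auto
    then show ?thesis
      using r(1) by (simp add: abs_mult)
  qed
  then show "\<exists>M. \<forall>f\<in>A. \<bar>f x\<bar> \<le> M"
    by blast
next
  assume A: "A \<subseteq> E \<and> (\<forall>x\<in>Y. \<exists>M. \<forall>f\<in>A. \<bar>f x\<bar> \<le> M)"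
  then obtain M where M: "\<bar>f x\<bar> \<le> M x" if "x \<in> Y" "f \<in> A" for x f
    by metis
  show "tvs_bounded T A"
    unfolding tvs_bounded_def
  proof (intro conjI allI impI)
    show "A \<subseteq> topspace T"
      using A by simp
    fix U assume U: "openin T U \<and> 0 \<in> U"
    then obtain F e where F: "finite F" "F \<subseteq> Y" and e: "0 < e"
      and FU: "\<And>g. g \<in> E \<Longrightarrow> (\<forall>x\<in>F. \<bar>g x - 0 x\<bar> < e) \<Longrightarrow> g \<in> U"
      unfolding openin_T by meson
    \<comment> \<open>The summand 1 makes \<open>r\<close> positive and the resulting estimate
      \<open>\<bar>f x\<bar> < s * e\<close> strict.\<close>
    define r where "r = (1 + (\<Sum>x\<in>F. \<bar>M x\<bar>)) / e"
    have r0: "r > 0"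
      unfolding r_def using e by (simp add: add_pos_nonneg sum_nonneg)
    have "A \<subseteq> (*\<^sub>R) s ` U" if s: "s \<ge> r" for s
    proof
      fix f assume f: "f \<in> A"
      have "\<bar>f x\<bar> / s < e" if x: "x \<in> F" for x
      proof -
        have "\<bar>f x\<bar> \<le> \<bar>M x\<bar>"
          using M[of x f] f x F(2) by fastforce
        also have "\<dots> \<le> (\<Sum>x\<in>F. \<bar>M x\<bar>)"
          using F(1) x by (intro member_le_sum) auto
        also have "\<dots> < r * e"
          unfolding r_def using e by simp
        also have "\<dots> \<le> s * e"
          using s e by simp
        finally show ?thesis
          using s r0 by (simp add: field_simps)
      qed
      then have "(1 / s) *\<^sub>R f \<in> U"
        using f A s r0 by (intro FU E_scale) (auto simp: abs_mult)
      moreover have "f = s *\<^sub>R ((1 / s) *\<^sub>R f)"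
        using s r0 by simp
      ultimately show "f \<in> (*\<^sub>R) s ` U"
        by blast
    qed
    then show "\<exists>r>0. \<forall>s\<ge>r. A \<subseteq> (*\<^sub>R) s ` U"
      using r0 by blast
  qed
qed

lemma dualD:
  assumes "\<phi> \<in> dual T"
  shows dual_add: "f \<in> E \<Longrightarrow> g \<in> E \<Longrightarrow> \<phi> (f + g) = \<phi> f + \<phi> g"
    and dual_scale: "f \<in> E \<Longrightarrow> \<phi> (c *\<^sub>R f) = c * \<phi> f"
    and dual_diff: "f \<in> E \<Longrightarrow> g \<in> E \<Longrightarrow> \<phi> (f - g) = \<phi> f - \<phi> g"
    and dual_outside: "f \<notin> E \<Longrightarrow> \<phi> f = 0"
    and dual_zero: "\<phi> 0 = 0"
proof -
  show add: "\<phi> (f + g) = \<phi> f + \<phi> g" if "f \<in> E" "g \<in> E" for f g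
    using assms that by (simp add: dual_def linear_map_on_def)
  show scale: "\<phi> (c *\<^sub>R f) = c * \<phi> f" if "f \<in> E" for c f
    using assms that by (simp add: dual_def linear_map_on_def)
  show "\<phi> (f - g) = \<phi> f - \<phi> g" if "f \<in> E" "g \<in> E" for f g
    using add[of f "(-1) *\<^sub>R g"] scale[of g "-1"] E_scale[of g "-1"] that by simp
  show "f \<notin> E \<Longrightarrow> \<phi> f = 0"
    using assms by (simp add: dual_def zero_outside_def)
  show "\<phi> 0 = 0"
    using scale[OF E_zero, of 0] by simp
qed

text \<open>Continuity at zero gives a finite \<open>F\<close> such that
  \<open>\<bar>\<phi>\<bar> < 1\<close> on all functions that are small on \<open>F\<close>. If
  \<open>f\<close> and \<open>g\<close> agree on \<open>F\<close>, every multiple of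
  \<open>f - g\<close> is small there, so \<open>\<phi> (f - g)\<close> cannot be nonzero.\<close>

lemma dual_finite_support:
  assumes "\<phi> \<in> dual T"
  obtains F where "finite F" "F \<subseteq> Y"
    "\<And>f g. f \<in> E \<Longrightarrow> g \<in> E \<Longrightarrow> (\<forall>x\<in>F. f x = g x) \<Longrightarrow> \<phi> f = \<phi> g"
proof -
  have "openin T {f \<in> topspace T. \<phi> f \<in> {-1<..<1}}"
    using assms by (intro openin_continuous_map_preimage[where Y = euclideanreal])
      (auto simp: dual_def)
  moreover have "0 \<in> {f \<in> topspace T. \<phi> f \<in> {-1<..<1}}"
    using assms E_zero by (simp add: dual_zero)
  ultimately obtain F e where F: "finite F" "F \<subseteq> Y" and e: "0 < e"
    and Fe: "\<And>g. g \<in> E \<Longrightarrow> (\<forall>x\<in>F. \<bar>g x - 0 x\<bar> < e) \<Longrightarrow> g \<in> {f \<in> topspace T. \<phi> f \<in> {-1<..<1}}"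
    unfolding openin_T by meson
  have "\<phi> f = \<phi> g" if fg: "f \<in> E" "g \<in> E" "\<forall>x\<in>F. f x = g x" for f g
  proof (rule ccontr)
    assume ne: "\<phi> f \<noteq> \<phi> g"
    let ?c = "1 / (\<phi> f - \<phi> g)"
    have "?c *\<^sub>R (f - g) \<in> {f \<in> topspace T. \<phi> f \<in> {-1<..<1}}"
      using fg e by (intro Fe E_scale E_diff) auto
    moreover have "\<phi> (?c *\<^sub>R (f - g)) = 1"
      using fg ne by (simp add: dual_scale[OF assms E_diff] dual_diff[OF assms])
    ultimately show False
      by simp
  qed
  then show ?thesis
    using F that by blast
qed

text \<open>The value 0 outside \<open>E\<close> is forced by \<open>dual\<close>, whose members
  vanish outside the carrier.\<close>

definition point_eval :: "'a \<Rightarrow> ('a \<Rightarrow> real) \<Rightarrow> real" where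
  "point_eval x = (\<lambda>f. if f \<in> E then f x else 0)"

lemma point_eval_in_dual:
  assumes "x \<in> Y"
  shows "point_eval x \<in> dual T"
proof -
  have "continuous_map T euclideanreal (point_eval x)"
    unfolding continuous_map_closedin
  proof (intro conjI allI impI)
    fix C :: "real set" assume "closedin euclideanreal C"
    then have "closedin T {g\<in>E. g x \<in> C}"
      using closedin_T_point assms by simp
    moreover have "{f \<in> topspace T. point_eval x f \<in> C} = {g\<in>E. g x \<in> C}"
      by (auto simp: point_eval_def)
    ultimately show "closedin T {f \<in> topspace T. point_eval x f \<in> C}"
      by simp
  qed auto
  then show ?thesis
    unfolding dual_def zero_outside_def linear_map_on_def
    by (auto simp: point_eval_def E_add E_scale)
qed

end

section \<open>Consequences of interpolation\<close>

text \<open>Complete regularity of \<open>X\<close> will enter through this hypothesis. The bound on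
  \<open>g\<close> keeps all interpolants inside a single bounded set.\<close>

locale interpolating_function_space = function_space +
  assumes interpolate:
    "\<lbrakk>finite F; F \<subseteq> Y; \<And>x. \<bar>f x\<bar> \<le> 1\<rbrakk> \<Longrightarrow> \<exists>g\<in>E. (\<forall>x\<in>F. g x = f x) \<and> (\<forall>x. \<bar>g x\<bar> \<le> 1)"
begin

definition unit_ball :: "('a \<Rightarrow> real) set" where
  "unit_ball = {g\<in>E. \<forall>x. \<bar>g x\<bar> \<le> 1}"

lemma closedin_unit_ball: "closedin T unit_ball"
proof -
  \<comment> \<open>Inserting \<open>E\<close> keeps the family nonempty, and its intersection
    inside \<open>E\<close>, when \<open>Y\<close> is empty.\<close>
  have "closedin T (\<Inter> (insert E ((\<lambda>x. {g\<in>E. g x \<in> {-1..1}}) ` Y)))"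
    using closedin_topspace[of T] by (intro closedin_Inter) (auto simp del: atLeastAtMost_iff intro!: closedin_T_point)
  moreover have "\<Inter> (insert E ((\<lambda>x. {g\<in>E. g x \<in> {-1..1}}) ` Y)) = unit_ball"
  proof -
    have "\<bar>g x\<bar> \<le> 1" if "g \<in> E" "x \<notin> Y" for g x
      using E_subset that by (auto simp: zero_outside_def)
    then show ?thesis
      unfolding unit_ball_def by (force simp: abs_le_iff)
  qed
  ultimately show ?thesis
    by simp
qed

text \<open>The factor \<open>c\<close> is for the semi-reflexive case, where the polar of a
  multiple of the ball gives the continuity estimate; the other two cases take
  \<open>c = 1\<close>.\<close>

lemma tvs_bounded_unit_ball: "tvs_bounded T ((\<lambda>g. c *\<^sub>R g) ` unit_ball)"
proof -
  have "\<bar>f x\<bar> \<le> \<bar>c\<bar>" if "f \<in> (\<lambda>g. c *\<^sub>R g) ` unit_ball" for f x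
    using that by (auto simp: unit_ball_def abs_mult intro!: mult_left_le)
  then show ?thesis
    unfolding tvs_bounded_T using E_scale unfolding unit_ball_def by blast
qed

lemma interpolate_unit_ball:
  assumes "finite F" "F \<subseteq> Y" "\<And>x. \<bar>f x\<bar> \<le> 1"
  shows "\<exists>g\<in>unit_ball. \<forall>x\<in>F. g x = f x"
  using interpolate[OF assms(1,2), of f] assms(3) unfolding unit_ball_def by blast

text \<open>By interpolation the closed conditions \<open>g x = f x\<close> have the finite
  intersection property inside \<open>unit_ball\<close>. Compactness gives one \<open>g\<close>
  meeting all of them, and off \<open>Y\<close> both functions vanish.\<close>

lemma semi_Montel_imp_mem:
  assumes "semi_Montel T" and f: "f \<in> zero_outside Y" "\<And>x. \<bar>f x\<bar> \<le> 1"
  shows "f \<in> E"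
proof -
  have "compactin T unit_ball"
    using assms(1) tvs_bounded_unit_ball[of 1] closure_of_eq closedin_unit_ball
    unfolding semi_Montel_def by (metis (no_types, lifting) image_cong image_ident scaleR_one)
  moreover define \<C> where "\<C> = (\<lambda>x. {g\<in>E. g x \<in> {f x}}) ` Y"
  have "closedin T C" if "C \<in> \<C>" for C
    using that closedin_T_point[OF _ closed_singleton] unfolding \<C>_def by blast
  moreover have "unit_ball \<inter> \<Inter>\<F> \<noteq> {}" if \<F>: "finite \<F>" "\<F> \<subseteq> \<C>" for \<F>
  proof -
    obtain F where F: "F \<subseteq> Y" "finite F" "\<F> = (\<lambda>x. {g\<in>E. g x \<in> {f x}}) ` F"
      using finite_subset_image[OF \<F>[unfolded \<C>_def]] by blast
    obtain g where "g \<in> unit_ball" "\<forall>x\<in>F. g x = f x"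
      using interpolate_unit_ball[of F f] F(1,2) f(2) by blast
    then have "g \<in> unit_ball \<inter> \<Inter>\<F>"
      by (auto simp: F(3) unit_ball_def)
    then show ?thesis
      by blast
  qed
  ultimately have "unit_ball \<inter> \<Inter>\<C> \<noteq> {}"
    unfolding compactin_fip by blast
  then obtain g where g: "g \<in> E" "\<And>x. x \<in> Y \<Longrightarrow> g x = f x"
    unfolding \<C>_def unit_ball_def by auto
  then have "g = f"
    using f(1) E_subset unfolding zero_outside_def by fastforce
  then show ?thesis
    using g(1) by simp
qed

text \<open>Interpolants indexed by the finite subsets of \<open>Y\<close>, ordered by inclusion,
  form a net that is eventually constant with value \<open>f x\<close> at each \<open>x\<close> in
  \<open>Y\<close>. It is therefore Cauchy, and its limit must be \<open>f\<close>.\<close>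

lemma quasi_complete_imp_mem:
  assumes "quasi_complete T" and f: "f \<in> zero_outside Y" "\<And>x. \<bar>f x\<bar> \<le> 1"
  shows "f \<in> E"
proof -
  define I where "I = {F. finite F \<and> F \<subseteq> Y}"
  have "\<exists>g. g \<in> unit_ball \<and> (\<forall>x\<in>F. g x = f x)" if "F \<in> I" for F
    using interpolate_unit_ball[of F f] f(2) that unfolding I_def by auto
  then obtain g where g: "\<And>F. F \<in> I \<Longrightarrow> g F \<in> unit_ball"
      "\<And>F x. F \<in> I \<Longrightarrow> x \<in> F \<Longrightarrow> g F x = f x"
    by metis
  have "complete_set T unit_ball"
    using assms(1) tvs_bounded_unit_ball[of 1] closedin_unit_ball
    unfolding quasi_complete_def by (simp add: scaleR_one[abs_def] del: scaleR_fun_apply)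
  moreover have "directed_index I (\<subseteq>)"
    unfolding directed_index_def
  proof (intro conjI ballI)
    show "I \<noteq> {}"
      by (auto simp: I_def)
    fix F G assume "F \<in> I" "G \<in> I"
    then have "F \<union> G \<in> I"
      by (simp add: I_def)
    then show "\<exists>H\<in>I. F \<subseteq> H \<and> G \<subseteq> H"
      by blast
  qed (auto simp: reflp_on_def transp_on_def)
  moreover have "g ` I \<subseteq> unit_ball"
    using g(1) by blast
  moreover have "Cauchy_net T I (\<subseteq>) g"
    unfolding Cauchy_net_def
  proof (intro allI impI)
    fix U assume "openin T U \<and> 0 \<in> U"
    then obtain F e where F: "finite F" "F \<subseteq> Y" and e: "0 < e"
      and FU: "\<And>g. g \<in> E \<Longrightarrow> (\<forall>x\<in>F. \<bar>g x - 0 x\<bar> < e) \<Longrightarrow> g \<in> U"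
      unfolding openin_T by meson
    have "g G - g H \<in> U" if "G \<in> I" "H \<in> I" "F \<subseteq> G \<and> F \<subseteq> H" for G H
    proof (rule FU)
      show "g G - g H \<in> E"
        using g(1) that by (intro E_diff) (auto simp: unit_ball_def)
      show "\<forall>x\<in>F. \<bar>(g G - g H) x - 0 x\<bar> < e"
        using g(2) that e by (auto simp: subset_iff)
    qed
    then show "\<exists>F\<in>I. \<forall>G\<in>I. \<forall>H\<in>I. F \<subseteq> G \<and> F \<subseteq> H \<longrightarrow> g G - g H \<in> U"
      using F by (intro bexI[of _ F]) (simp_all add: I_def)
  qed
  \<comment> \<open>The index set consists of subsets of \<open>Y\<close>, not of elements of the
    type fixed in \<open>complete_set\<close>, hence the passage through
    \<open>complete_set_any_index_type\<close>.\<close>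
  ultimately obtain l where l: "l \<in> unit_ball" "net_converges T I (\<subseteq>) g l"
    using complete_set_any_index_type by blast
  have "l x = f x" if "x \<in> Y" for x
  proof (rule ccontr)
    assume "l x \<noteq> f x"
    \<comment> \<open>The radius is the distance between the two values, so \<open>?U\<close>
      contains no function with value \<open>f x\<close> at \<open>x\<close>.\<close>
    let ?U = "{h\<in>E. \<forall>y\<in>{x}. \<bar>h y - l y\<bar> < \<bar>f x - l x\<bar>}"
    have "openin T ?U" "l \<in> ?U"
      using that l(1) \<open>l x \<noteq> f x\<close> openin_T_basic[of "{x}"] by (auto simp: unit_ball_def)
    then obtain F where F: "F \<in> I" "\<And>G. G \<in> I \<Longrightarrow> F \<subseteq> G \<Longrightarrow> g G \<in> ?U"
      using l(2)[unfolded net_converges_def, THEN conjunct2, rule_format, of ?U] by blast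
    have "insert x F \<in> I"
      using F(1) that by (simp add: I_def)
    with F(2)[OF this] g(2)[OF this, of x] show False
      by auto
  qed
  then have "l = f"
    using f(1) l(1) E_subset unfolding zero_outside_def unit_ball_def by fastforce
  then show ?thesis
    using l(1) by (simp add: unit_ball_def)
qed

text \<open>Although \<open>f\<close> may lie outside \<open>E\<close>, each \<open>\<phi>\<close>
  in the dual has a natural value at \<open>f\<close>, since it depends on finitely many coordinates
  only. These values form an element \<open>\<xi>\<close> of the bidual, and a preimage of
  \<open>\<xi>\<close> under the canonical embedding has the values of \<open>f\<close>, as point
  evaluations show.\<close>

lemma semi_reflexive_imp_mem:
  assumes "semi_reflexive T" and f: "f \<in> zero_outside Y" "\<And>x. \<bar>f x\<bar> \<le> 1"
  shows "f \<in> E"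
proof -
  \<comment> \<open>\<open>P \<phi> c\<close> expresses that \<open>c\<close> is the value of
    \<open>\<phi>\<close> at \<open>f\<close>: it is attained at every member of \<open>E\<close>
    that agrees with \<open>f\<close> on some fixed finite set. This replaces an explicit expansion
    of \<open>\<phi>\<close> into point evaluations.\<close>
  define P where "P \<phi> c \<longleftrightarrow>
    (\<exists>F. finite F \<and> F \<subseteq> Y \<and> (\<forall>g\<in>E. (\<forall>x\<in>F. g x = f x) \<longrightarrow> \<phi> g = c))"
    for \<phi> :: "('a \<Rightarrow> real) \<Rightarrow> real" and c
  \<comment> \<open>One interpolant on the union of the two finite sets realizes both values.
    Uniqueness of the value follows, and that the interpolant lies in \<open>unit_ball\<close> is
    what makes \<open>\<xi>\<close> continuous.\<close>
  have P2: "\<exists>g\<in>unit_ball. \<phi> g = c \<and> \<psi> g = d" if "P \<phi> c" "P \<psi> d" for \<phi> \<psi> c d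
  proof -
    obtain F G where FG: "finite F" "F \<subseteq> Y" "\<forall>g\<in>E. (\<forall>x\<in>F. g x = f x) \<longrightarrow> \<phi> g = c"
      "finite G" "G \<subseteq> Y" "\<forall>g\<in>E. (\<forall>x\<in>G. g x = f x) \<longrightarrow> \<psi> g = d"
      using \<open>P \<phi> c\<close> \<open>P \<psi> d\<close> unfolding P_def by blast
    obtain g where "g \<in> unit_ball" "\<forall>x\<in>F \<union> G. g x = f x"
      using interpolate_unit_ball[OF finite_UnI[OF FG(1,4)] Un_least[OF FG(2,5)], of f] f(2) by blast
    then show ?thesis
      using FG(3,6) by (auto simp: unit_ball_def)
  qed
  have P_unique: "c = d" if "P \<phi> c" "P \<phi> d" for \<phi> c d
    using P2[OF that] by blast
  have P_ex: "\<exists>c. P \<phi> c" if "\<phi> \<in> dual T" for \<phi>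
  proof -
    obtain F where F: "finite F" "F \<subseteq> Y"
      "\<And>g h. g \<in> E \<Longrightarrow> h \<in> E \<Longrightarrow> (\<forall>x\<in>F. g x = h x) \<Longrightarrow> \<phi> g = \<phi> h"
      using dual_finite_support[OF \<open>\<phi> \<in> dual T\<close>] by blast
    obtain h where h: "h \<in> unit_ball" "\<forall>x\<in>F. h x = f x"
      using interpolate_unit_ball[of F f] F(1,2) f(2) by blast
    have "\<phi> g = \<phi> h" if "g \<in> E" "\<forall>x\<in>F. g x = f x" for g
      using that h by (intro F(3)) (auto simp: unit_ball_def)
    then show ?thesis
      unfolding P_def using F by blast
  qed
  have P_add: "P (\<phi> + \<psi>) (c + d)" if PP: "P \<phi> c" "P \<psi> d" for \<phi> \<psi> c d
  proof -
    obtain F G where FG: "finite F" "F \<subseteq> Y" "\<forall>g\<in>E. (\<forall>x\<in>F. g x = f x) \<longrightarrow> \<phi> g = c"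
      "finite G" "G \<subseteq> Y" "\<forall>g\<in>E. (\<forall>x\<in>G. g x = f x) \<longrightarrow> \<psi> g = d"
      using PP unfolding P_def by blast
    then show ?thesis
      unfolding P_def by (intro exI[of _ "F \<union> G"]) simp
  qed
  have P_scale: "P (a *\<^sub>R \<phi>) (a * c)" if "P \<phi> c" for \<phi> a c
    using that unfolding P_def by (auto simp: scaleR_fun_def)
  define \<xi> where "\<xi> \<phi> = (if \<phi> \<in> dual T then (SOME c. P \<phi> c) else 0)" for \<phi>
  have \<xi>: "P \<phi> (\<xi> \<phi>)" if "\<phi> \<in> dual T" for \<phi>
    using P_ex[OF that] that unfolding \<xi>_def by (simp add: someI_ex)
  have \<xi>_eq: "\<xi> \<phi> = c" if "\<phi> \<in> dual T" "P \<phi> c" for \<phi> c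
    using \<xi> P_unique that by blast
  note sub = subspace_add[OF subspace_dual] subspace_scale[OF subspace_dual]
  have lin: "linear_map_on (dual T) \<xi>"
    unfolding linear_map_on_def using \<xi> P_add P_scale sub by (auto intro!: \<xi>_eq)
  have "continuous_map (strong_dual T) euclideanreal \<xi>"
    unfolding continuous_map_def
  proof (intro conjI allI impI)
    fix V :: "real set" assume "openin euclideanreal V"
    then have "open V"
      by simp
    show "openin (strong_dual T) {\<phi> \<in> topspace (strong_dual T). \<xi> \<phi> \<in> V}"
      unfolding openin_strong_dual
    proof (intro conjI ballI)
      fix \<phi> assume "\<phi> \<in> {\<phi> \<in> topspace (strong_dual T). \<xi> \<phi> \<in> V}"
      then have \<phi>: "\<phi> \<in> dual T" "\<xi> \<phi> \<in> V"
        by auto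
      then obtain e where e: "e > 0" "ball (\<xi> \<phi>) e \<subseteq> V"
        using \<open>open V\<close> open_contains_ball by blast
      \<comment> \<open>On the polar of this multiple of the ball \<open>\<xi>\<close> is at most
        \<open>e / 2\<close> in absolute value, since each of its values is attained on
        \<open>unit_ball\<close>; the factor 2 gives strict inequality.\<close>
      let ?A = "(\<lambda>g. (2 / e) *\<^sub>R g) ` unit_ball"
      have "\<xi> \<omega> \<in> V" if \<omega>: "\<omega> \<in> dual T" "\<omega> - \<phi> \<in> polar T ?A" for \<omega>
      proof -
        have d: "\<omega> - \<phi> \<in> dual T"
          using \<omega>(2) by (simp add: polar_def)
        obtain g where g: "g \<in> unit_ball" "(\<omega> - \<phi>) g = \<xi> (\<omega> - \<phi>)"
          using P2[OF \<xi>[OF d] \<xi>[OF d]] by blast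
        have "\<xi> \<omega> = \<xi> (\<omega> - \<phi>) + \<xi> \<phi>"
          using lin d \<phi>(1) unfolding linear_map_on_def by (metis diff_add_cancel)
        moreover have "\<bar>(\<omega> - \<phi>) ((2 / e) *\<^sub>R g)\<bar> \<le> 1"
          using \<omega>(2) g(1) unfolding polar_def by blast
        then have "2 / e * \<bar>(\<omega> - \<phi>) g\<bar> \<le> 1"
          using dual_scale[OF d, of g "2 / e"] g(1) e(1)
          by (simp add: unit_ball_def abs_mult del: minus_apply)
        then have "\<bar>\<xi> (\<omega> - \<phi>)\<bar> < e"
          using e(1) g(2) by (simp add: field_simps)
        ultimately have "\<xi> \<omega> \<in> ball (\<xi> \<phi>) e"
          by (simp add: dist_real_def)
        then show ?thesis
          using e(2) by blast
      qed
      then show "\<exists>A. tvs_bounded T A \<and> (\<forall>\<omega>\<in>dual T. \<omega> - \<phi> \<in> polar T A \<longrightarrow>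
          \<omega> \<in> {\<phi> \<in> topspace (strong_dual T). \<xi> \<phi> \<in> V})"
        by (intro exI[of _ ?A]) (simp add: tvs_bounded_unit_ball)
    qed auto
  qed auto
  then have "\<xi> \<in> topspace (bidual T)"
    using lin by (simp add: dual_def[of "strong_dual T"] zero_outside_def \<xi>_def)
  then obtain h where h: "h \<in> E" "\<xi> = canonical_embedding T h"
    using assms(1) unfolding semi_reflexive_def by auto
  have "h x = f x" if "x \<in> Y" for x
  proof -
    have "P (point_eval x) (f x)"
      unfolding P_def point_eval_def using that by (intro exI[of _ "{x}"]) auto
    then have "\<xi> (point_eval x) = f x"
      using \<xi>_eq point_eval_in_dual that by blast
    then show ?thesis
      using h point_eval_in_dual[OF that] by (simp add: canonical_embedding_def point_eval_def)
  qed
  then have "h = f"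
    using f(1) h(1) E_subset unfolding zero_outside_def by fastforce
  then show ?thesis
    using h(1) by simp
qed

end

section \<open>The space of all functions\<close>

locale full_function_space = function_space +
  assumes E_eq: "E = zero_outside Y"
begin

section \<open>Completeness and relative compactness in the full power\<close>

lemma mem_E: "f \<in> E \<longleftrightarrow> (\<forall>x. x \<notin> Y \<longrightarrow> f x = 0)"
  using E_eq by (simp add: zero_outside_def)

text \<open>Each coordinate is a Cauchy net of reals. A neighbourhood of the pointwise limit
  involves finitely many coordinates, and directedness provides an index beyond all of
  theirs.\<close>

lemma complete_space_T: "complete_space T"
  unfolding complete_space_def complete_set_def topspace_T
proof (intro allI impI, elim conjE)
  fix I :: "(('a \<Rightarrow> real) set \<times> ('a \<Rightarrow> real)) set" and le h
  assume dir: "directed_index I le" and hE: "h ` I \<subseteq> E" and Cau: "Cauchy_net T I le h"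
  have "\<exists>L. \<forall>e>0. \<exists>i\<in>I. \<forall>j\<in>I. le i j \<longrightarrow> \<bar>h j x - L\<bar> < e" if x: "x \<in> Y" for x
  proof (rule real_Cauchy_net_converges[OF dir])
    fix e :: real assume "e > 0"
    let ?U = "{g\<in>E. \<forall>y\<in>{x}. \<bar>g y - 0 y\<bar> < e}"
    have "openin T ?U \<and> 0 \<in> ?U"
      using x \<open>e > 0\<close> openin_T_basic[of "{x}" 0 e] E_zero by simp
    then obtain i where i: "i \<in> I" "\<forall>j\<in>I. \<forall>k\<in>I. le i j \<and> le i k \<longrightarrow> h j - h k \<in> ?U"
      using Cau[unfolded Cauchy_net_def, rule_format, of ?U] by blast
    then show "\<exists>i\<in>I. \<forall>j\<in>I. \<forall>k\<in>I. le i j \<and> le i k \<longrightarrow> \<bar>h j x - h k x\<bar> < e"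
      by (intro bexI[of _ i]) auto
  qed
  then obtain L where L: "\<And>x e. x \<in> Y \<Longrightarrow> e > 0 \<Longrightarrow> \<exists>i\<in>I. \<forall>j\<in>I. le i j \<longrightarrow> \<bar>h j x - L x\<bar> < e"
    by metis
  define l where "l = (\<lambda>x. if x \<in> Y then L x else 0)"
  have l: "l \<in> E"
    by (simp add: mem_E l_def)
  have "net_converges T I le h l"
    unfolding net_converges_def
  proof (intro conjI allI impI)
    fix U assume U: "openin T U \<and> l \<in> U"
    then obtain F e where F: "finite F" "F \<subseteq> Y" and e: "0 < e"
      and FU: "\<And>g. g \<in> E \<Longrightarrow> (\<forall>x\<in>F. \<bar>g x - l x\<bar> < e) \<Longrightarrow> g \<in> U"
      unfolding openin_T by meson
    have "\<forall>x\<in>F. \<exists>i. i \<in> I \<and> (\<forall>j\<in>I. le i j \<longrightarrow> \<bar>h j x - L x\<bar> < e)"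
      using L F(2) e by blast
    then obtain i where i: "\<And>x. x \<in> F \<Longrightarrow> i x \<in> I"
        "\<And>x j. x \<in> F \<Longrightarrow> j \<in> I \<Longrightarrow> le (i x) j \<Longrightarrow> \<bar>h j x - L x\<bar> < e"
      by metis
    obtain k where k: "k \<in> I" "\<And>x. x \<in> F \<Longrightarrow> le (i x) k"
      using directed_index_finite_upper_bound[OF dir, of "i ` F"] F(1) i(1) by blast
    have "h j \<in> U" if j: "j \<in> I" "le k j" for j
    proof (rule FU)
      have "le (i x) j" if "x \<in> F" for x
        using dir k(1) k(2)[OF that] i(1)[OF that] j unfolding directed_index_def transp_on_def
        by blast
      then show "\<forall>x\<in>F. \<bar>h j x - l x\<bar> < e"
        using i(2) j(1) F(2) by (auto simp: l_def)
    qed (use hE j in blast)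
    then show "\<exists>i\<in>I. \<forall>j\<in>I. le i j \<longrightarrow> h j \<in> U"
      using k(1) by blast
  qed (simp add: l)
  then show "\<exists>l\<in>E. net_converges T I le h l"
    using l by blast
qed

text \<open>Pointwise bounds confine the closure to a product of compact intervals, which is compact
  by the theorem of Tychonoff.\<close>

lemma semi_Montel_T: "semi_Montel T"
  unfolding semi_Montel_def
proof (intro allI impI)
  fix A assume "tvs_bounded T A"
  then obtain M where A: "A \<subseteq> E" and M: "\<And>x f. x \<in> Y \<Longrightarrow> f \<in> A \<Longrightarrow> \<bar>f x\<bar> \<le> M x"
    unfolding tvs_bounded_T by metis
  \<comment> \<open>\<open>?h\<close> turns functions undefined outside \<open>Y\<close> into
    functions that vanish there; it carries the compact product into \<open>T\<close>.\<close>
  let ?h = "\<lambda>f x. if x \<in> Y then f x else (0::real)"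
  let ?K = "PiE Y (\<lambda>x. {- M x..M x})"
  have "continuous_map (powertop_real Y) T ?h"
    unfolding T_def
  proof (rule continuous_map_pullback')
    show "continuous_map (powertop_real Y) (powertop_real Y) ((\<lambda>f. restrict f Y) \<circ> ?h)"
      by (rule continuous_map_eq[OF continuous_map_id]) (auto simp: fun_eq_iff PiE_iff extensional_def)
  qed (auto simp: mem_E)
  moreover have "compactin (powertop_real Y) ?K"
    by (simp add: compactin_PiE)
  ultimately have "compactin T (?h ` ?K)"
    by (rule image_compactin[rotated])
  moreover have "T closure_of A \<subseteq> ?h ` ?K"
  proof
    fix f assume f: "f \<in> T closure_of A"
    have "f x \<in> {- M x..M x}" if x: "x \<in> Y" for x
    proof -
      have "A \<subseteq> {g\<in>E. g x \<in> {- M x..M x}}"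
        using A M[OF x] by (auto simp: abs_le_iff) (smt (verit, best))
      then have "T closure_of A \<subseteq> {g\<in>E. g x \<in> {- M x..M x}}"
        using closedin_T_point[OF x closed_atLeastAtMost] by (rule closure_of_minimal)
      then show ?thesis
        using f by blast
    qed
    moreover have "f \<in> zero_outside Y"
      using f closure_of_subset_topspace[of T A] unfolding topspace_T E_eq[symmetric] by blast
    ultimately show "f \<in> ?h ` ?K"
      by (intro image_eqI[of _ _ "restrict f Y"]) (auto simp: zero_outside_def)
  qed
  ultimately show "compactin T (T closure_of A)"
    using closed_compactin closedin_closure_of by blast
qed

section \<open>The dual of the full power and its bounded subsets\<close>

definition mass :: "'a \<Rightarrow> 'a \<Rightarrow> real" where
  "mass x y = (if y = x then 1 else 0)"

lemma mass_in_E: "x \<in> Y \<Longrightarrow> mass x \<in> E"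
  by (auto simp: mem_E mass_def)

lemma dual_mass_support:
  assumes \<phi>: "\<phi> \<in> dual T"
  shows "\<exists>F. finite F \<and> F \<subseteq> Y \<and> (\<forall>x\<in>Y - F. \<phi> (mass x) = 0) \<and>
    (\<forall>f\<in>E. \<forall>g\<in>E. (\<forall>x\<in>F. f x = g x) \<longrightarrow> \<phi> f = \<phi> g)"
proof -
  obtain F where F: "finite F" "F \<subseteq> Y"
    "\<And>f g. f \<in> E \<Longrightarrow> g \<in> E \<Longrightarrow> (\<forall>x\<in>F. f x = g x) \<Longrightarrow> \<phi> f = \<phi> g"
    using dual_finite_support[OF \<phi>] by blast
  have zero: "\<phi> (mass x) = 0" if "x \<in> Y" "x \<notin> F" for x
  proof -
    have "\<forall>y\<in>F. mass x y = 0 y"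
      using that by (auto simp: mass_def)
    then show ?thesis
      using F(3)[OF mass_in_E E_zero] that dual_zero[OF \<phi>] by simp
  qed
  then show ?thesis
    by (intro exI[of _ F] conjI ballI impI F(1,2) zero F(3)) auto
qed

lemma finite_dual_support:
  assumes "\<phi> \<in> dual T"
  shows "finite {x\<in>Y. \<phi> (mass x) \<noteq> 0}"
proof -
  obtain F where "finite F" "\<forall>x\<in>Y - F. \<phi> (mass x) = 0"
    using dual_mass_support[OF assms] by blast
  then show ?thesis
    by (blast intro: finite_subset)
qed

text \<open>On its finite support \<open>\<phi>\<close> does not distinguish \<open>g\<close> from a
  combination of unit vectors \<open>mass x\<close>. The set \<open>S\<close> may exceed the points
  where \<open>\<phi>\<close> has mass, so that one \<open>S\<close> can serve for a whole family of
  functionals.\<close>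

lemma dual_eq_sum_masses:
  assumes \<phi>: "\<phi> \<in> dual T" and S: "finite S" "{x\<in>Y. \<phi> (mass x) \<noteq> 0} \<subseteq> S" "S \<subseteq> Y" and g: "g \<in> E"
  shows "\<phi> g = (\<Sum>x\<in>S. \<phi> (mass x) * g x)"
proof -
  obtain F where F: "finite F" "F \<subseteq> Y" "\<forall>x\<in>Y - F. \<phi> (mass x) = 0"
    "\<forall>f\<in>E. \<forall>g\<in>E. (\<forall>x\<in>F. f x = g x) \<longrightarrow> \<phi> f = \<phi> g"
    using dual_mass_support[OF \<phi>] by blast
  let ?h = "\<Sum>x\<in>F. g x *\<^sub>R mass x"
  have sum: "(\<Sum>x\<in>G. g x *\<^sub>R mass x) \<in> E" if "G \<subseteq> Y" for G
    using that mass_in_E by (intro subspace_sum subspace_E E_scale) blast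
  have "?h x = g x" if "x \<in> F" for x
    using F(1) that by (simp add: sum_fun_apply mass_def if_distrib cong: if_cong)
  then have "\<phi> g = \<phi> ?h"
    using sum[OF F(2)] g by (intro F(4)[rule_format]) auto
  also have "\<dots> = (\<Sum>x\<in>F. \<phi> (mass x) * g x)"
    using F(1,2)
  proof (induction F rule: finite_induct)
    case (insert x G)
    then have "g x *\<^sub>R mass x \<in> E" "mass x \<in> E" "(\<Sum>x\<in>G. g x *\<^sub>R mass x) \<in> E"
      using sum mass_in_E E_scale by blast+
    with insert show ?case
      by (simp add: dual_add[OF \<phi>] dual_scale[OF \<phi>] del: plus_fun_apply scaleR_fun_apply)
  qed (simp add: dual_zero[OF \<phi>])
  also have "\<dots> = (\<Sum>x\<in>F \<union> S. \<phi> (mass x) * g x)"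
    using F(1,2) S F(3) by (intro sum.mono_neutral_left) auto
  also have "\<dots> = (\<Sum>x\<in>S. \<phi> (mass x) * g x)"
    using F(1,2) S by (intro sum.mono_neutral_right) auto
  finally show ?thesis .
qed

text \<open>Boundedness is tested on open sets, so the polar of \<open>A\<close> is replaced by the
  set \<open>U\<close> of functionals bounded on \<open>A\<close> by a constant strictly below 1. It
  is open, and some multiple of it contains \<open>B\<close>.\<close>

lemma bounded_strong_dual_uniform:
  assumes B: "tvs_bounded (strong_dual T) B" and A: "tvs_bounded T A"
  shows "\<exists>K. \<forall>\<phi>\<in>B. \<forall>f\<in>A. \<bar>\<phi> f\<bar> \<le> K"
proof -
  define U where "U = {\<phi> \<in> dual T. \<exists>s<1. \<forall>f\<in>A. \<bar>\<phi> f\<bar> \<le> s}"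
  have "openin (strong_dual T) U"
    unfolding openin_strong_dual
  proof (intro conjI ballI)
    fix \<phi> assume "\<phi> \<in> U"
    then obtain s where s: "s < 1" "\<And>f. f \<in> A \<Longrightarrow> \<bar>\<phi> f\<bar> \<le> s"
      unfolding U_def by blast
    \<comment> \<open>The factor limits the perturbation on \<open>A\<close> to half the gap between
      \<open>s\<close> and 1.\<close>
    let ?A = "(\<lambda>f. (2 / (1 - s)) *\<^sub>R f) ` A"
    have "\<exists>M. \<forall>f\<in>?A. \<bar>f x\<bar> \<le> M" if x: "x \<in> Y" for x
    proof -
      obtain M where "\<forall>f\<in>A. \<bar>f x\<bar> \<le> M"
        using A x unfolding tvs_bounded_T by blast
      then have "\<forall>f\<in>?A. \<bar>f x\<bar> \<le> 2 / (1 - s) * M"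
        using s(1) by (auto simp: abs_mult intro!: mult_left_mono divide_right_mono)
      then show ?thesis
        by blast
    qed
    then have "tvs_bounded T ?A"
      using A E_scale unfolding tvs_bounded_T by blast
    moreover have "\<omega> \<in> U" if \<omega>: "\<omega> \<in> dual T" "\<omega> - \<phi> \<in> polar T ?A" for \<omega>
    proof -
      have "\<bar>\<omega> f\<bar> \<le> s + (1 - s) / 2" if f: "f \<in> A" for f
      proof -
        have d: "\<omega> - \<phi> \<in> dual T"
          using \<omega>(2) by (simp add: polar_def)
        have "f \<in> E"
          using f A by (auto simp: tvs_bounded_T)
        moreover have "\<bar>(\<omega> - \<phi>) ((2 / (1 - s)) *\<^sub>R f)\<bar> \<le> 1"
          using \<omega>(2) f unfolding polar_def by blast
        ultimately have "2 / (1 - s) * \<bar>(\<omega> - \<phi>) f\<bar> \<le> 1"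
          using dual_scale[OF d, of f "2 / (1 - s)"] s(1) by (simp add: abs_mult del: minus_apply)
        then have "\<bar>(\<omega> - \<phi>) f\<bar> \<le> (1 - s) / 2"
          using s(1) by (simp add: field_simps del: minus_apply)
        then show ?thesis
          using s(2)[OF f] unfolding minus_apply by linarith
      qed
      moreover have "s + (1 - s) / 2 < 1"
        using s(1) by (simp add: field_simps)
      ultimately show ?thesis
        unfolding U_def using \<omega>(1) by blast
    qed
    ultimately show "\<exists>A. tvs_bounded T A \<and> (\<forall>\<omega>\<in>dual T. \<omega> - \<phi> \<in> polar T A \<longrightarrow> \<omega> \<in> U)"
      by blast
  qed (auto simp: U_def)
  moreover have "0 \<in> U"
    using subspace_0[OF subspace_dual] by (auto simp: U_def intro!: exI[of _ "0::real"])
  ultimately obtain r where r: "r > 0" "\<forall>s\<ge>r. B \<subseteq> (*\<^sub>R) s ` U"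
    using B unfolding tvs_bounded_def by blast
  have "\<bar>\<phi> f\<bar> \<le> r" if "\<phi> \<in> B" "f \<in> A" for \<phi> f
  proof -
    have "\<phi> \<in> (*\<^sub>R) r ` U"
      using r(2) that by blast
    then obtain \<psi> where "\<psi> \<in> U" "\<phi> = r *\<^sub>R \<psi>"
      by blast
    then show ?thesis
      using that(2) r(1) by (fastforce simp: U_def abs_mult intro!: mult_left_le)
  qed
  then show ?thesis
    by blast
qed

text \<open>
  If infinitely many points carried mass of members of \<open>B\<close>, scaling the corresponding
  \<^term>\<open>mass x\<close> suitably would give a pointwise bounded set on which \<open>B\<close> is unbounded.
\<close>

lemma bounded_strong_dual_finite_support:
  assumes B: "tvs_bounded (strong_dual T) B"
  shows "finite {x\<in>Y. \<exists>\<phi>\<in>B. \<phi> (mass x) \<noteq> 0}" (is "finite ?S")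
proof (rule ccontr)
  assume "infinite ?S"
  then obtain s :: "nat \<Rightarrow> 'a" where s: "inj s" "range s \<subseteq> ?S"
    using infinite_countable_subset by blast
  then have "\<forall>n. \<exists>\<phi>\<in>B. \<phi> (mass (s n)) \<noteq> 0" and sY: "\<And>n. s n \<in> Y"
    by blast+
  then obtain \<phi> where \<phi>: "\<And>n. \<phi> n \<in> B" "\<And>n. \<phi> n (mass (s n)) \<noteq> 0"
    by metis
  \<comment> \<open>The factor yields \<open>\<phi> n (a n) = n\<close>. As \<open>s\<close> is
    injective, at most one \<open>a n\<close> is nonzero at any given point, so the family is
    pointwise bounded.\<close>
  define a where "a n = (real n / \<phi> n (mass (s n))) *\<^sub>R mass (s n)" for n
  have "\<exists>M. \<forall>f\<in>range a. \<bar>f x\<bar> \<le> M" for x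
  proof (cases "\<exists>n. x = s n")
    case True
    then obtain n where n: "x = s n"
      by blast
    have "\<bar>a m x\<bar> \<le> \<bar>a n x\<bar>" for m
      using n s(1) by (auto simp: a_def mass_def inj_eq)
    then show ?thesis
      by blast
  next
    case False
    then show ?thesis
      by (auto simp: a_def mass_def)
  qed
  then have "tvs_bounded T (range a)"
    unfolding tvs_bounded_T using mass_in_E[OF sY] by (auto simp: a_def E_scale)
  then obtain K where K: "\<And>\<phi> n. \<phi> \<in> B \<Longrightarrow> \<bar>\<phi> (a n)\<bar> \<le> K"
    using bounded_strong_dual_uniform[OF B] by blast
  have "B \<subseteq> dual T"
    using B by (simp add: tvs_bounded_def)
  then have "\<phi> n (a n) = n" for n
    using \<phi> dual_scale[of "\<phi> n" "mass (s n)"] mass_in_E[OF sY, of n] unfolding a_def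
    by (metis nonzero_eq_divide_eq subsetD)
  then have "real n \<le> K" for n
    using K[OF \<phi>(1), of n n] by simp
  then show False
    using reals_Archimedean2 not_less by blast
qed

text \<open>A bounded \<open>A\<close> is bounded at each of the finitely many points of
  \<open>F\<close>, so its polar absorbs these functionals. Their own polars in the bidual control
  values on \<open>F\<close>, which makes the canonical embedding open.\<close>

lemma tvs_bounded_point_evals:
  assumes F: "finite F" "F \<subseteq> Y"
  shows "tvs_bounded (strong_dual T) ((\<lambda>x. c *\<^sub>R point_eval x) ` F)" (is "tvs_bounded _ ?B")
  unfolding tvs_bounded_def
proof (intro conjI allI impI)
  note scale = subspace_scale[OF subspace_dual]
  show "?B \<subseteq> topspace (strong_dual T)"
    using F(2) point_eval_in_dual scale by (auto simp del: scaleR_fun_apply intro!: scale)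
  fix U assume U: "openin (strong_dual T) U \<and> 0 \<in> U"
  then obtain A where A: "tvs_bounded T A" "\<forall>\<omega>\<in>dual T. \<omega> - 0 \<in> polar T A \<longrightarrow> \<omega> \<in> U"
    unfolding openin_strong_dual by blast
  then obtain M where M: "\<And>x f. x \<in> Y \<Longrightarrow> f \<in> A \<Longrightarrow> \<bar>f x\<bar> \<le> M x"
    unfolding tvs_bounded_T by metis
  define r where "r = 1 + (\<Sum>x\<in>F. \<bar>c\<bar> * \<bar>M x\<bar>)"
  have "r > 0"
    unfolding r_def by (simp add: add_pos_nonneg sum_nonneg)
  moreover have "?B \<subseteq> (*\<^sub>R) s ` U" if s: "s \<ge> r" for s
  proof
    fix \<phi> assume "\<phi> \<in> ?B"
    then obtain x where x: "x \<in> F" "\<phi> = c *\<^sub>R point_eval x"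
      by blast
    have "s > 0"
      using s \<open>r > 0\<close> by linarith
    have d: "(1 / s) *\<^sub>R \<phi> \<in> dual T"
      unfolding x(2) using x(1) F(2) point_eval_in_dual scale by blast
    have "\<bar>((1 / s) *\<^sub>R \<phi>) f\<bar> \<le> 1" if f: "f \<in> A" for f
    proof -
      have "\<bar>c\<bar> * \<bar>f x\<bar> \<le> \<bar>c\<bar> * \<bar>M x\<bar>"
        using M[of x f] f x F(2) by (intro mult_left_mono) force+
      also have "\<dots> \<le> (\<Sum>x\<in>F. \<bar>c\<bar> * \<bar>M x\<bar>)"
        using F(1) x by (intro member_le_sum) auto
      also have "\<dots> \<le> s"
        using s unfolding r_def by simp
      finally show ?thesis
        using \<open>s > 0\<close> x(2) by (simp add: point_eval_def abs_mult)
    qed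
    then have "(1 / s) *\<^sub>R \<phi> \<in> U"
      using A(2) d by (simp add: polar_def)
    moreover have "\<phi> = s *\<^sub>R ((1 / s) *\<^sub>R \<phi>)"
      using \<open>s > 0\<close> by simp
    ultimately show "\<phi> \<in> (*\<^sub>R) s ` U"
      by blast
  qed
  ultimately show "\<exists>r>0. \<forall>s\<ge>r. ?B \<subseteq> (*\<^sub>R) s ` U"
    by blast
qed

text \<open>All members of \<open>B\<close> are supported on one finite set \<open>S\<close> with
  coefficients bounded by one \<open>K\<close>, so smallness on \<open>S\<close> controls them
  simultaneously. This equicontinuity makes the canonical embedding continuous.\<close>

lemma bounded_strong_dual_equicontinuous:
  assumes B: "tvs_bounded (strong_dual T) B"
  shows "\<exists>F e. finite F \<and> F \<subseteq> Y \<and> 0 < e \<and>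
    (\<forall>g\<in>E. (\<forall>x\<in>F. \<bar>g x\<bar> < e) \<longrightarrow> (\<forall>\<phi>\<in>B. \<bar>\<phi> g\<bar> \<le> 1))"
proof -
  define S where "S = {x\<in>Y. \<exists>\<phi>\<in>B. \<phi> (mass x) \<noteq> 0}"
  have S: "finite S" "S \<subseteq> Y"
    using bounded_strong_dual_finite_support[OF B] by (auto simp: S_def)
  have "\<exists>M. \<forall>f\<in>mass ` S. \<bar>f x\<bar> \<le> M" for x
    by (auto simp: mass_def intro!: exI[of _ "1::real"])
  then have "tvs_bounded T (mass ` S)"
    unfolding tvs_bounded_T using mass_in_E S(2) by blast
  then obtain K where K: "\<And>\<phi> x. \<phi> \<in> B \<Longrightarrow> x \<in> S \<Longrightarrow> \<bar>\<phi> (mass x)\<bar> \<le> K"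
    using bounded_strong_dual_uniform[OF B] by blast
  \<comment> \<open>Chosen so that \<open>card S\<close> terms of size at most
    \<open>\<bar>K\<bar> * e\<close> sum to at most 1; the added 1 keeps the denominator
    positive.\<close>
  define e where "e = 1 / (1 + real (card S) * \<bar>K\<bar>)"
  have e: "e > 0" "real (card S) * \<bar>K\<bar> * e \<le> 1"
    unfolding e_def by (auto simp: add_pos_nonneg)
  have "\<bar>\<phi> g\<bar> \<le> 1" if g: "g \<in> E" "\<forall>x\<in>S. \<bar>g x\<bar> < e" and \<phi>: "\<phi> \<in> B" for g \<phi>
  proof -
    have "\<phi> \<in> dual T"
      using B \<phi> by (auto simp: tvs_bounded_def)
    then have "\<bar>\<phi> g\<bar> = \<bar>\<Sum>x\<in>S. \<phi> (mass x) * g x\<bar>"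
      using \<phi> by (subst dual_eq_sum_masses[OF _ S(1) _ S(2) g(1)]) (auto simp: S_def)
    also have "\<dots> \<le> (\<Sum>x\<in>S. \<bar>\<phi> (mass x) * g x\<bar>)"
      by (rule sum_abs)
    also have "\<dots> \<le> (\<Sum>x\<in>S. \<bar>K\<bar> * e)"
      unfolding abs_mult using K[OF \<phi>] g(2) by (intro sum_mono mult_mono) force+
    also have "\<dots> \<le> 1"
      using e(2) by (simp add: mult.assoc)
    finally show ?thesis .
  qed
  then show ?thesis
    using S e(1) by blast
qed

section \<open>Reflexivity of the full power\<close>

text \<open>A one-point set is bounded, so the polar of \<open>f\<close> scaled by
  \<open>2 / e\<close> may be used in the strong dual; on it evaluation at \<open>f\<close> is at
  most \<open>e / 2\<close> in absolute value.\<close>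

lemma canonical_embedding_in_bidual:
  assumes f: "f \<in> E"
  shows "canonical_embedding T f \<in> topspace (bidual T)"
proof -
  note sub = subspace_add[OF subspace_dual] subspace_scale[OF subspace_dual]
  have "continuous_map (strong_dual T) euclideanreal (canonical_embedding T f)"
    unfolding continuous_map_def
  proof (intro conjI allI impI)
    fix V :: "real set" assume "openin euclideanreal V"
    then have "open V"
      by simp
    show "openin (strong_dual T) {\<phi> \<in> topspace (strong_dual T). canonical_embedding T f \<phi> \<in> V}"
      unfolding openin_strong_dual
    proof (intro conjI ballI)
      fix \<phi> assume "\<phi> \<in> {\<phi> \<in> topspace (strong_dual T). canonical_embedding T f \<phi> \<in> V}"
      then have \<phi>: "\<phi> \<in> dual T" "\<phi> f \<in> V"
        by (auto simp: canonical_embedding_def)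
      then obtain e where e: "e > 0" "ball (\<phi> f) e \<subseteq> V"
        using \<open>open V\<close> open_contains_ball by blast
      have bd: "tvs_bounded T {(2 / e) *\<^sub>R f}"
        unfolding tvs_bounded_T using f by (auto simp: E_scale)
      have "\<omega> f \<in> V" if \<omega>: "\<omega> \<in> dual T" "\<omega> - \<phi> \<in> polar T {(2 / e) *\<^sub>R f}" for \<omega>
      proof -
        have d: "\<omega> - \<phi> \<in> dual T" "\<bar>(\<omega> - \<phi>) ((2 / e) *\<^sub>R f)\<bar> \<le> 1"
          using \<omega>(2) unfolding polar_def by blast+
        have "2 / e * \<bar>(\<omega> - \<phi>) f\<bar> \<le> 1"
          using d(2) dual_scale[OF d(1) f] e(1) by (simp add: abs_mult del: minus_apply)
        then have "2 / e * \<bar>\<omega> f - \<phi> f\<bar> \<le> 1"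
          by simp
        then have "\<omega> f \<in> ball (\<phi> f) e"
          using e(1) by (simp add: dist_real_def field_simps abs_minus_commute)
        then show ?thesis
          using e(2) by blast
      qed
      then show "\<exists>A. tvs_bounded T A \<and> (\<forall>\<omega>\<in>dual T. \<omega> - \<phi> \<in> polar T A \<longrightarrow>
          \<omega> \<in> {\<phi> \<in> topspace (strong_dual T). canonical_embedding T f \<phi> \<in> V})"
        using bd by (intro exI[of _ "{(2 / e) *\<^sub>R f}"]) (simp add: canonical_embedding_def)
    qed auto
  qed auto
  then show ?thesis
    by (auto simp: dual_def[of "strong_dual T"] zero_outside_def linear_map_on_def
        canonical_embedding_def sub)
qed

text \<open>Each functional in the dual is a finite combination of point evaluations, so the values
  of \<open>\<xi>\<close> on these determine it and are the values of the preimage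
  \<open>f\<close>.\<close>

lemma canonical_embedding_surj:
  assumes \<xi>: "\<xi> \<in> topspace (bidual T)"
  shows "\<exists>f\<in>E. canonical_embedding T f = \<xi>"
proof -
  have lin: "linear_map_on (dual T) \<xi>" and out: "\<And>\<phi>. \<phi> \<notin> dual T \<Longrightarrow> \<xi> \<phi> = 0"
    using \<xi> by (auto simp: dual_def[of "strong_dual T"] zero_outside_def)
  define f where "f x = (if x \<in> Y then \<xi> (point_eval x) else 0)" for x
  have f: "f \<in> E"
    by (simp add: mem_E f_def)
  note sub = subspace_add[OF subspace_dual] subspace_scale[OF subspace_dual]
    subspace_0[OF subspace_dual]
  have sum_in_dual: "(\<Sum>x\<in>S. c x *\<^sub>R point_eval x) \<in> dual T" if "S \<subseteq> Y" for S c
    using that point_eval_in_dual by (intro subspace_sum subspace_dual sub) blast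
  have sum: "\<xi> (\<Sum>x\<in>S. c x *\<^sub>R point_eval x) = (\<Sum>x\<in>S. c x * f x)"
    if "finite S" "S \<subseteq> Y" for S c
    using that
  proof (induction S rule: finite_induct)
    case empty
    have "\<xi> (0 *\<^sub>R 0) = 0 *\<^sub>R \<xi> 0"
      using lin sub(3) unfolding linear_map_on_def by blast
    then show ?case
      by (simp del: zero_fun_apply)
  next
    case (insert x S)
    then have x: "x \<in> Y" "point_eval x \<in> dual T"
      using point_eval_in_dual by auto
    then have "\<xi> (c x *\<^sub>R point_eval x) = c x * f x"
      using lin by (simp add: linear_map_on_def f_def)
    moreover have "\<xi> (c x *\<^sub>R point_eval x + (\<Sum>x\<in>S. c x *\<^sub>R point_eval x)) =
        \<xi> (c x *\<^sub>R point_eval x) + \<xi> (\<Sum>x\<in>S. c x *\<^sub>R point_eval x)"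
      using lin sub(2)[OF x(2)] sum_in_dual[of S c] insert.prems unfolding linear_map_on_def by blast
    ultimately show ?case
      using insert by (simp del: plus_fun_apply scaleR_fun_apply)
  qed
  have "\<xi> \<phi> = \<phi> f" if \<phi>: "\<phi> \<in> dual T" for \<phi>
  proof -
    define S where "S = {x\<in>Y. \<phi> (mass x) \<noteq> 0}"
    have S: "finite S" "S \<subseteq> Y"
      using finite_dual_support[OF \<phi>] by (auto simp: S_def)
    have eq: "\<phi> g = (\<Sum>x\<in>S. \<phi> (mass x) * g x)" if "g \<in> E" for g
      using dual_eq_sum_masses[OF \<phi> S(1) _ S(2) that] by (simp add: S_def)
    have "\<phi> g = (\<Sum>x\<in>S. \<phi> (mass x) *\<^sub>R point_eval x) g" for g
      using eq[of g] dual_outside[OF \<phi>, of g]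
      by (cases "g \<in> E") (simp_all add: sum_fun_apply point_eval_def)
    then have "\<phi> = (\<Sum>x\<in>S. \<phi> (mass x) *\<^sub>R point_eval x)"
      by blast
    then show ?thesis
      using sum[OF S, of "\<lambda>x. \<phi> (mass x)"] eq[OF f] by metis
  qed
  then have "canonical_embedding T f = \<xi>"
    using out by (auto simp: canonical_embedding_def fun_eq_iff)
  then show ?thesis
    using f by blast
qed

lemma canonical_embedding_image: "canonical_embedding T ` E = topspace (bidual T)"
  using canonical_embedding_in_bidual canonical_embedding_surj by blast

lemma canonical_embedding_diff:
  "f \<in> E \<Longrightarrow> g \<in> E \<Longrightarrow>
    canonical_embedding T g - canonical_embedding T f = canonical_embedding T (g - f)"
  by (auto simp: canonical_embedding_def fun_eq_iff dual_diff)

text \<open>Continuity is equicontinuity of the bounded sets of the dual; openness comes from the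
  bounded sets formed by finitely many point evaluations.\<close>

lemma reflexive_T: "reflexive T"
  unfolding reflexive_def topological_isomorphism_def
proof
  let ?\<psi> = "canonical_embedding T"
  show "linear_map_on (topspace T) ?\<psi>"
    by (auto simp: linear_map_on_def canonical_embedding_def fun_eq_iff dual_add dual_scale)
  show "homeomorphic_map T (bidual T) ?\<psi>"
  proof (rule bijective_open_imp_homeomorphic_map)
    show "?\<psi> ` topspace T = topspace (bidual T)"
      using canonical_embedding_image by simp
    show "inj_on ?\<psi> (topspace T)"
    proof (rule inj_onI)
      fix f g assume fg: "f \<in> topspace T" "g \<in> topspace T" "?\<psi> f = ?\<psi> g"
      have "f x = g x" if "x \<in> Y" for x
        using fun_cong[OF fg(3), of "point_eval x"] fg(1,2) point_eval_in_dual[OF that]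
        by (simp add: canonical_embedding_def point_eval_def)
      moreover have "f x = g x" if "x \<notin> Y" for x
        using fg(1,2) that by (simp add: mem_E)
      ultimately show "f = g"
        by blast
    qed
    show "continuous_map T (bidual T) ?\<psi>"
      unfolding continuous_map_def
    proof (intro conjI allI impI)
      show "?\<psi> \<in> topspace T \<rightarrow> topspace (bidual T)"
        using canonical_embedding_in_bidual by auto
      fix U assume U: "openin (bidual T) U"
      show "openin T {f \<in> topspace T. ?\<psi> f \<in> U}"
        unfolding openin_T
      proof (intro conjI ballI)
        fix f assume "f \<in> {f \<in> topspace T. ?\<psi> f \<in> U}"
        then have f: "f \<in> E" "?\<psi> f \<in> U"
          by auto
        then obtain B where B: "tvs_bounded (strong_dual T) B"
            "\<And>\<omega>. \<omega> \<in> dual (strong_dual T) \<Longrightarrow> \<omega> - ?\<psi> f \<in> polar (strong_dual T) B \<Longrightarrow> \<omega> \<in> U"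
          using U[unfolded openin_strong_dual, THEN conjunct2, rule_format, OF f(2)] by blast
        obtain F e where Fe: "finite F" "F \<subseteq> Y" "0 < e"
            "\<And>g. g \<in> E \<Longrightarrow> \<forall>x\<in>F. \<bar>g x\<bar> < e \<Longrightarrow> \<forall>\<phi>\<in>B. \<bar>\<phi> g\<bar> \<le> 1"
          using bounded_strong_dual_equicontinuous[OF B(1)] by meson
        have "?\<psi> g \<in> U" if g: "g \<in> E" "\<forall>x\<in>F. \<bar>g x - f x\<bar> < e" for g
        proof (rule B(2))
          show "?\<psi> g \<in> dual (strong_dual T)"
            using canonical_embedding_in_bidual[OF g(1)] by simp
          have "\<forall>\<phi>\<in>B. \<bar>\<phi> (g - f)\<bar> \<le> 1"
            using Fe(4)[OF E_diff[OF g(1) f(1)]] g(2) by simp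
          moreover have "B \<subseteq> dual T"
            using B(1) by (simp add: tvs_bounded_def)
          ultimately show "?\<psi> g - ?\<psi> f \<in> polar (strong_dual T) B"
            using canonical_embedding_in_bidual[OF E_diff[OF g(1) f(1)]]
            unfolding canonical_embedding_diff[OF f(1) g(1)]
            by (auto simp: polar_def canonical_embedding_def)
        qed
        then show "\<exists>F e. finite F \<and> F \<subseteq> Y \<and> 0 < e \<and>
            (\<forall>g\<in>E. (\<forall>x\<in>F. \<bar>g x - f x\<bar> < e) \<longrightarrow> g \<in> {f \<in> topspace T. ?\<psi> f \<in> U})"
          using Fe(1-3) by (intro exI[of _ F] exI[of _ e]) simp
      qed auto
    qed
    show "open_map T (bidual T) ?\<psi>"
      unfolding open_map_def
    proof (intro allI impI)
      fix U assume U: "openin T U"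
      then have UE: "U \<subseteq> E"
        using openin_subset by fastforce
      show "openin (bidual T) (?\<psi> ` U)"
        unfolding openin_strong_dual[of "strong_dual T"]
      proof (intro conjI ballI)
        show "?\<psi> ` U \<subseteq> dual (strong_dual T)"
          using UE canonical_embedding_in_bidual by auto
        fix \<xi> assume "\<xi> \<in> ?\<psi> ` U"
        then obtain f where f: "f \<in> U" "\<xi> = ?\<psi> f"
          by blast
        then obtain F e where F: "finite F" "F \<subseteq> Y" and e: "0 < e"
          and FU: "\<And>g. g \<in> E \<Longrightarrow> (\<forall>x\<in>F. \<bar>g x - f x\<bar> < e) \<Longrightarrow> g \<in> U"
          using U unfolding openin_T by meson
        \<comment> \<open>The polar of \<open>?B\<close> forces
          \<open>\<bar>g x - f x\<bar> \<le> e / 2\<close> on \<open>F\<close>.\<close>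
        let ?B = "(\<lambda>x. (2 / e) *\<^sub>R point_eval x) ` F"
        have "\<omega> \<in> ?\<psi> ` U"
          if \<omega>: "\<omega> \<in> dual (strong_dual T)" "\<omega> - \<xi> \<in> polar (strong_dual T) ?B" for \<omega>
        proof -
          obtain g where g: "g \<in> E" "\<omega> = ?\<psi> g"
            using canonical_embedding_surj[of \<omega>] \<omega>(1) by auto
          have fE: "f \<in> E"
            using f(1) UE by blast
          have "\<bar>g x - f x\<bar> < e" if x: "x \<in> F" for x
          proof -
            have d: "(2 / e) *\<^sub>R point_eval x \<in> dual T"
              using x F(2) point_eval_in_dual subspace_scale[OF subspace_dual] by blast
            have "\<bar>?\<psi> (g - f) ((2 / e) *\<^sub>R point_eval x)\<bar> \<le> 1"
              using \<omega>(2) x unfolding f(2) g(2) canonical_embedding_diff[OF fE g(1)] polar_def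
              by blast
            then have "\<bar>2 / e * (g x - f x)\<bar> \<le> 1"
              using d e E_diff[OF g(1) fE] by (simp add: canonical_embedding_def point_eval_def)
            then have "2 / e * \<bar>g x - f x\<bar> \<le> 1"
              using e by (simp only: abs_mult) simp
            then show ?thesis
              using e by (simp add: field_simps)
          qed
          then show ?thesis
            using FU g by blast
        qed
        then show "\<exists>A. tvs_bounded (strong_dual T) A \<and>
            (\<forall>\<omega>\<in>dual (strong_dual T). \<omega> - \<xi> \<in> polar (strong_dual T) A \<longrightarrow> \<omega> \<in> ?\<psi> ` U)"
          using tvs_bounded_point_evals[OF F] by blast
      qed
    qed
  qed
qed

end

section \<open>Baire-one functions\<close>

text \<open>Continuity concerns the carrier only, so resetting to 0 off it is harmless; approximants
  and functions defining zero-sets can henceforth be arbitrary continuous maps.\<close>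

lemma cont_functions_restrict:
  assumes "continuous_map X euclideanreal g"
  shows "(\<lambda>x. if x \<in> topspace X then g x else 0) \<in> cont_functions X"
  unfolding cont_functions_def zero_outside_def using assms by (auto intro: continuous_map_eq)

lemma Baire_oneI:
  assumes "f \<in> zero_outside (topspace X)" "\<And>n. continuous_map X euclideanreal (g n)"
    and "\<And>x. x \<in> topspace X \<Longrightarrow> (\<lambda>n. g n x) \<longlonglongrightarrow> f x"
  shows "f \<in> Baire_one X"
  unfolding Baire_one_def using assms
  by (auto intro!: exI[of _ "\<lambda>n x. if x \<in> topspace X then g n x else 0"] cont_functions_restrict)

lemma Baire_oneE:
  assumes "f \<in> Baire_one X"
  obtains g where "\<And>n. continuous_map X euclideanreal (g n)"
    "\<And>x. x \<in> topspace X \<Longrightarrow> (\<lambda>n. g n x) \<longlonglongrightarrow> f x"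
  using assms unfolding Baire_one_def cont_functions_def by blast

section \<open>Zero-sets and their countable unions\<close>

lemma zero_set_iff:
  "zero_set X A \<longleftrightarrow> (\<exists>f. continuous_map X euclideanreal f \<and> A = {x \<in> topspace X. f x = 0})"
proof
  assume "\<exists>f. continuous_map X euclideanreal f \<and> A = {x \<in> topspace X. f x = 0}"
  then obtain f where "continuous_map X euclideanreal f" "A = {x \<in> topspace X. f x = 0}"
    by blast
  then show "zero_set X A"
    unfolding zero_set_def
    by (intro bexI[of _ "\<lambda>x. if x \<in> topspace X then f x else 0"] cont_functions_restrict) auto
qed (auto simp: zero_set_def cont_functions_def)

lemma Zer_sigma_set_iff:
  "Zer_sigma_set X A \<longleftrightarrow> (\<exists>z :: nat \<Rightarrow> 'a \<Rightarrow> real. (\<forall>n. continuous_map X euclideanreal (z n)) \<and>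
     A = {x \<in> topspace X. \<exists>n. z n x = 0})" for X :: "'a topology"
proof
  assume "Zer_sigma_set X A"
  then obtain \<U> where \<U>: "countable \<U>" "\<And>Z. Z \<in> \<U> \<Longrightarrow> zero_set X Z" "\<Union>\<U> = A"
    unfolding Zer_sigma_set_def union_of_def by auto
  \<comment> \<open>The empty zero-set is added because a family must be nonempty to be enumerated
    by the natural numbers.\<close>
  have "zero_set X {}"
    unfolding zero_set_iff by (intro exI[of _ "\<lambda>x. 1"]) simp
  then have Z: "zero_set X (from_nat_into (insert {} \<U>) n)" for n
    using from_nat_into[OF insert_not_empty, of "{}" \<U> n] \<U>(2) by (elim insertE) simp_all
  then have "\<forall>n. \<exists>f. continuous_map X euclideanreal f \<and>
      from_nat_into (insert {} \<U>) n = {x \<in> topspace X. f x = 0}"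
    unfolding zero_set_iff by blast
  then obtain z where z: "\<forall>n. continuous_map X euclideanreal (z n) \<and>
      from_nat_into (insert {} \<U>) n = {x \<in> topspace X. z n x = 0}"
    by (rule choice[THEN exE])
  have "A = (\<Union>n. from_nat_into (insert {} \<U>) n)"
    using \<U>(1,3) by (simp add: range_from_nat_into)
  then show "\<exists>z :: nat \<Rightarrow> 'a \<Rightarrow> real. (\<forall>n. continuous_map X euclideanreal (z n)) \<and>
     A = {x \<in> topspace X. \<exists>n. z n x = 0}"
    using z by (intro exI[of _ z]) auto
next
  assume "\<exists>z :: nat \<Rightarrow> 'a \<Rightarrow> real. (\<forall>n. continuous_map X euclideanreal (z n)) \<and>
     A = {x \<in> topspace X. \<exists>n. z n x = 0}"
  then obtain z :: "nat \<Rightarrow> 'a \<Rightarrow> real" where z: "\<And>n. continuous_map X euclideanreal (z n)"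
     "A = {x \<in> topspace X. \<exists>n. z n x = 0}"
    by blast
  have "zero_set X {x \<in> topspace X. z n x = 0}" for n
    unfolding zero_set_iff using z(1)[of n] by blast
  then show "Zer_sigma_set X A"
    unfolding Zer_sigma_set_def union_of_def
    using z(2) by (intro exI[of _ "range (\<lambda>n. {x \<in> topspace X. z n x = 0})"]) auto
qed

lemma Coz_delta_setI:
  assumes "Zer_sigma_set X (topspace X - A)" "A \<subseteq> topspace X"
  shows "Coz_delta_set X A"
proof -
  obtain \<U> where \<U>: "countable \<U>" "\<And>Z. Z \<in> \<U> \<Longrightarrow> zero_set X Z" "\<Union>\<U> = topspace X - A"
    using assms(1) unfolding Zer_sigma_set_def union_of_def by auto
  have "cozero_set X (topspace X - Z)" if "Z \<in> \<U>" for Z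
    unfolding cozero_set_def using \<U>(2)[OF that] by blast
  then have "(countable intersection_of cozero_set X) (\<Inter>((\<lambda>Z. topspace X - Z) ` \<U>))"
    unfolding intersection_of_def using \<U>(1)
    by (intro exI[of _ "(\<lambda>Z. topspace X - Z) ` \<U>"]) auto
  moreover have "topspace X \<inter> \<Inter>((\<lambda>Z. topspace X - Z) ` \<U>) = A"
    using \<U>(3) assms(2) by auto
  ultimately show ?thesis
    unfolding Coz_delta_set_def relative_to_def by blast
qed

text \<open>The condition ranges over all subsets, hence also over complements, and De Morgan
  supplies the \<open>Coz_delta_set\<close> half.\<close>

lemma Qf_space_iff_Zer_sigma: "Qf_space X \<longleftrightarrow> (\<forall>A\<subseteq>topspace X. Zer_sigma_set X A)"
  unfolding Qf_space_def CZ_set_def using Coz_delta_setI by blast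

text \<open>The series of \<open>min 1 \<bar>u n x\<bar> / 2 ^ n\<close> converges uniformly, and
  having nonnegative terms it vanishes exactly where all of them do. Thus zero-sets are closed under
  countable intersections.\<close>

lemma continuous_map_common_zero:
  assumes u: "\<And>n::nat. continuous_map X euclideanreal (u n)"
  shows "\<exists>h. continuous_map X euclideanreal h \<and> (\<forall>x\<in>topspace X. h x = 0 \<longleftrightarrow> (\<forall>n. u n x = 0))"
proof -
  define v where "v n x = min 1 \<bar>u n x\<bar> * (1 / 2) ^ n" for n x
  have v: "continuous_map X euclideanreal (v n)" "0 \<le> v n x" "norm (v n x) \<le> (1 / 2) ^ n" for n x
    unfolding v_def using u by (auto intro!: continuous_intros continuous_map_real_mult_right)
  define h where "h x = (\<Sum>n. v n x)" for x
  have sv: "summable (\<lambda>n. v n x)" for x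
    by (rule summable_comparison_test[OF _ summable_geometric[of "1/2 :: real"]]) (use v in auto)
  have "uniform_limit (topspace X) (\<lambda>n x. \<Sum>i<n. v i x) h sequentially"
    unfolding h_def by (rule Weierstrass_m_test[OF v(3)]) (simp add: summable_geometric)
  moreover have "continuous_map X euclideanreal (\<lambda>x. \<Sum>i<n. v i x)" for n
    by (intro continuous_map_sum v) auto
  ultimately have "continuous_map X Met_TC.mtopology h"
    by (intro Met_TC.continuous_map_uniform_limit[where F = sequentially
          and f = "\<lambda>n x. \<Sum>i<n. v i x"])
      (auto simp: uniform_limit_iff mtopology_is_euclidean)
  then have "continuous_map X euclideanreal h"
    by (simp add: mtopology_is_euclidean)
  moreover have "h x = 0 \<longleftrightarrow> (\<forall>n. u n x = 0)" for x
  proof -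
    have "h x = 0 \<longleftrightarrow> (\<forall>n. v n x = 0)"
      unfolding h_def using suminf_eq_zero_iff[OF sv v(2)] .
    moreover have "v n x = 0 \<longleftrightarrow> u n x = 0" for n
      by (auto simp: v_def min_def)
    ultimately show ?thesis
      by simp
  qed
  ultimately show ?thesis
    by blast
qed

lemma Zer_sigma_set_if_indicator_Baire_one:
  assumes A: "A \<subseteq> topspace X" and ind: "indicator A \<in> Baire_one X"
  shows "Zer_sigma_set X A"
proof -
  obtain g where g: "\<And>n. continuous_map X euclideanreal (g n)"
    "\<And>x. x \<in> topspace X \<Longrightarrow> (\<lambda>n. g n x) \<longlonglongrightarrow> indicator A x"
    using Baire_oneE[OF ind] by blast
  \<comment> \<open>\<open>max 0 (1 / 2 - t)\<close> vanishes exactly when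
    \<open>t \<ge> 1 / 2\<close>, so the zeros of \<open>z m\<close> below are the points where
    every \<open>g n\<close> with \<open>n \<ge> m\<close> is at least \<open>1 / 2\<close>.\<close>
  have "\<exists>h. continuous_map X euclideanreal h \<and>
      (\<forall>x\<in>topspace X. h x = 0 \<longleftrightarrow> (\<forall>n. max 0 (1 / 2 - g (m + n) x) = 0))" for m
    using g(1) by (intro continuous_map_common_zero continuous_intros) auto
  then obtain z where z: "\<And>m. continuous_map X euclideanreal (z m)"
      "\<And>m x. x \<in> topspace X \<Longrightarrow> z m x = 0 \<longleftrightarrow> (\<forall>n. max 0 (1 / 2 - g (m + n) x) = 0)"
    by metis
  have "x \<in> A \<longleftrightarrow> (\<exists>m. z m x = 0)" if x: "x \<in> topspace X" for x
  proof
    assume "x \<in> A"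
    then have "eventually (\<lambda>n. g n x > 1 / 2) sequentially"
      using order_tendstoD(1)[OF g(2)[OF x], of "1 / 2"] by simp
    then obtain m where "\<And>n. n \<ge> m \<Longrightarrow> g n x > 1 / 2"
      unfolding eventually_sequentially by blast
    then have "max 0 (1 / 2 - g (m + n) x) = 0" for n
      using less_imp_le[of "1 / 2" "g (m + n) x"] by simp
    then show "\<exists>m. z m x = 0"
      using z(2)[OF x] by blast
  next
    assume "\<exists>m. z m x = 0"
    then obtain m where m: "\<And>n. max 0 (1 / 2 - g (m + n) x) = 0"
      using z(2)[OF x] by blast
    have "g n x \<ge> 1 / 2" if "n \<ge> m" for n
      using m[of "n - m"] that by (simp add: max_def split: if_splits)
    then have "indicator A x \<ge> (1 / 2 :: real)"
      by (intro tendsto_lowerbound[OF g(2)[OF x]]) (auto simp: eventually_sequentially)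
    then show "x \<in> A"
      by (cases "x \<in> A") simp_all
  qed
  then have "A = {x \<in> topspace X. \<exists>m. z m x = 0}"
    using A by blast
  then show ?thesis
    unfolding Zer_sigma_set_iff using z(1) by blast
qed

text \<open>The product of the first \<open>n\<close> functions vanishes on the union of their
  zero-sets, and these unions increase to \<open>A\<close>.\<close>

lemma Zer_sigma_set_increasing:
  assumes "Zer_sigma_set X A"
  obtains p :: "nat \<Rightarrow> 'a \<Rightarrow> real" where "\<And>n. continuous_map X euclideanreal (p n)"
    "\<And>n x. x \<in> topspace X \<Longrightarrow> x \<notin> A \<Longrightarrow> p n x \<noteq> 0"
    "\<And>x. x \<in> A \<Longrightarrow> eventually (\<lambda>n. p n x = 0) sequentially"
proof -
  obtain z :: "nat \<Rightarrow> 'a \<Rightarrow> real" where z: "\<And>n. continuous_map X euclideanreal (z n)"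
     "A = {x \<in> topspace X. \<exists>n. z n x = 0}"
    using assms unfolding Zer_sigma_set_iff by blast
  show ?thesis
  proof
    show "continuous_map X euclideanreal (\<lambda>x. \<Prod>k<n. z k x)" for n
      by (induction n) (auto intro!: continuous_map_real_mult z)
    show "(\<Prod>k<n. z k x) \<noteq> 0" if "x \<in> topspace X" "x \<notin> A" for n x
      using that z(2) by simp
    show "eventually (\<lambda>n. (\<Prod>k<n. z k x) = 0) sequentially" if "x \<in> A" for x
    proof -
      obtain k where "z k x = 0"
        using \<open>x \<in> A\<close> z(2) by blast
      then show ?thesis
        unfolding eventually_sequentially by (intro exI[of _ "Suc k"]) auto
    qed
  qed
qed

text \<open>On the carrier \<open>p n\<close> and \<open>q n\<close> have no common zero, so the
  quotient \<open>\<bar>q n x\<bar> / (\<bar>p n x\<bar> + \<bar>q n x\<bar>)\<close> is continuous.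
  It is 1 at points of \<open>A\<close> once \<open>p n\<close> vanishes there, and 0 at the other
  points once \<open>q n\<close> does.\<close>

lemma indicator_limit_continuous:
  assumes "Zer_sigma_set X A" "Zer_sigma_set X (topspace X - A)"
  shows "\<exists>g :: nat \<Rightarrow> 'a \<Rightarrow> real. (\<forall>n. continuous_map X euclideanreal (g n)) \<and>
    (\<forall>n x. 0 \<le> g n x \<and> g n x \<le> 1) \<and> (\<forall>x\<in>topspace X. (\<lambda>n. g n x) \<longlonglongrightarrow> indicator A x)"
proof -
  obtain p where p: "\<And>n. continuous_map X euclideanreal (p n)"
    "\<And>n x. x \<in> topspace X \<Longrightarrow> x \<notin> A \<Longrightarrow> p n x \<noteq> 0"
    "\<And>x. x \<in> A \<Longrightarrow> eventually (\<lambda>n. p n x = 0) sequentially"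
    using Zer_sigma_set_increasing[OF assms(1)] by metis
  obtain q where q: "\<And>n. continuous_map X euclideanreal (q n)"
    "\<And>n x. x \<in> topspace X \<Longrightarrow> x \<notin> topspace X - A \<Longrightarrow> q n x \<noteq> 0"
    "\<And>x. x \<in> topspace X - A \<Longrightarrow> eventually (\<lambda>n. q n x = 0) sequentially"
    using Zer_sigma_set_increasing[OF assms(2)] by metis
  define g where "g n x = \<bar>q n x\<bar> / (\<bar>p n x\<bar> + \<bar>q n x\<bar>)" for n x
  have "continuous_map X euclideanreal (g n)" for n
  proof -
    have "\<bar>p n x\<bar> + \<bar>q n x\<bar> \<noteq> 0" if "x \<in> topspace X" for x
      using p(2)[OF that] q(2)[OF that] that by (cases "x \<in> A") (auto simp: add_nonneg_eq_0_iff)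
    then show ?thesis
      unfolding g_def using p(1) q(1)
      by (intro continuous_map_real_divide continuous_map_add continuous_map_real_abs) auto
  qed
  moreover have "0 \<le> g n x \<and> g n x \<le> 1" for n x
    by (auto simp: g_def divide_le_eq_1)
  moreover have "(\<lambda>n. g n x) \<longlonglongrightarrow> indicator A x" if x: "x \<in> topspace X" for x
  proof (cases "x \<in> A")
    case True
    then have "eventually (\<lambda>n. g n x = indicator A x) sequentially"
      using p(3)[OF True] q(2)[OF x] by (auto simp: g_def elim: eventually_mono)
    then show ?thesis
      by (rule tendsto_eventually)
  next
    case False
    then have "eventually (\<lambda>n. g n x = indicator A x) sequentially"
      using q(3)[of x] x by (auto simp: g_def elim: eventually_mono)
    then show ?thesis
      by (rule tendsto_eventually)
  qed
  ultimately show ?thesis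
    by blast
qed

section \<open>Binary expansion of functions into indicators\<close>

text \<open>Each term is the difference of two consecutive dyadic approximations
  \<open>\<lfloor>2 ^ k * y\<rfloor> / 2 ^ k\<close>, so the series telescopes; the first
  approximation is 0 because \<open>y\<close> lies in \<open>[0, 1)\<close>.\<close>

lemma binary_digits_sums:
  fixes y :: real
  assumes "0 \<le> y" "y < 1"
  shows "(\<lambda>k. of_int (\<lfloor>2 ^ Suc k * y\<rfloor> - 2 * \<lfloor>2 ^ k * y\<rfloor>) / 2 ^ Suc k) sums y"
proof -
  have "(\<lambda>k. of_int \<lfloor>2 ^ k * y\<rfloor> / 2 ^ k) \<longlonglongrightarrow> y"
  proof (rule tendsto_sandwich[of "\<lambda>k. y - (1 / 2) ^ k" _ _ "\<lambda>k. y"])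
    have "y - (1 / 2) ^ k \<le> of_int \<lfloor>2 ^ k * y\<rfloor> / 2 ^ k" for k
    proof -
      have "2 ^ k * y - 1 \<le> of_int \<lfloor>2 ^ k * y\<rfloor>"
        by linarith
      then have "(2 ^ k * y - 1) / 2 ^ k \<le> of_int \<lfloor>2 ^ k * y\<rfloor> / 2 ^ k"
        by (rule divide_right_mono) simp
      then show ?thesis
        by (simp add: diff_divide_distrib power_one_over)
    qed
    then show "\<forall>\<^sub>F k in sequentially. y - (1 / 2) ^ k \<le> of_int \<lfloor>2 ^ k * y\<rfloor> / 2 ^ k"
      by simp
    show "\<forall>\<^sub>F k in sequentially. of_int \<lfloor>2 ^ k * y\<rfloor> / 2 ^ k \<le> y"
      by (simp add: divide_le_eq mult.commute)
    show "(\<lambda>k. y - (1 / 2) ^ k) \<longlonglongrightarrow> y"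
      using tendsto_diff[OF tendsto_const[of y] LIMSEQ_realpow_zero[of "1 / 2"]] by simp
  qed simp
  from telescope_sums[OF this] show ?thesis
    using floor_eq_iff[of y 0] assms by (simp add: diff_divide_distrib)
qed

lemma binary_digit_cases: "\<lfloor>2 ^ Suc k * y\<rfloor> - 2 * \<lfloor>2 ^ k * y\<rfloor> \<in> {0, 1}" for y :: real
proof -
  have "2 ^ Suc k * y = 2 * (2 ^ k * y)"
    by simp
  then have "\<lfloor>2 ^ Suc k * y\<rfloor> = \<lfloor>2 * (2 ^ k * y)\<rfloor>"
    by metis
  then show ?thesis
    by (simp only: insert_iff) linarith
qed

lemma unit_interval_function_limit_continuous:
  fixes y :: "'a \<Rightarrow> real"
  assumes X: "\<And>A. A \<subseteq> topspace X \<Longrightarrow> Zer_sigma_set X A"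
    and y: "\<And>x. 0 \<le> y x \<and> y x < 1"
  obtains g :: "nat \<Rightarrow> 'a \<Rightarrow> real" where "\<And>n. continuous_map X euclideanreal (g n)"
    "\<And>x. x \<in> topspace X \<Longrightarrow> (\<lambda>n. g n x) \<longlonglongrightarrow> y x"
proof -
  define d where "d k x = \<lfloor>2 ^ Suc k * y x\<rfloor> - 2 * \<lfloor>2 ^ k * y x\<rfloor>" for k x
  define A where "A k = {x \<in> topspace X. d k x = 1}" for k
  have "\<forall>k. \<exists>g :: nat \<Rightarrow> 'a \<Rightarrow> real. (\<forall>n. continuous_map X euclideanreal (g n)) \<and>
    (\<forall>n x. 0 \<le> g n x \<and> g n x \<le> 1) \<and> (\<forall>x\<in>topspace X. (\<lambda>n. g n x) \<longlonglongrightarrow> indicator (A k) x)"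
    by (intro allI indicator_limit_continuous X) (auto simp: A_def)
  then obtain g :: "nat \<Rightarrow> nat \<Rightarrow> 'a \<Rightarrow> real" where
    g: "\<And>k n. continuous_map X euclideanreal (g k n)"
      "\<And>k n x. 0 \<le> g k n x \<and> g k n x \<le> 1"
      "\<And>k x. x \<in> topspace X \<Longrightarrow> (\<lambda>n. g k n x) \<longlonglongrightarrow> indicator (A k) x"
    by metis
  define h where "h n x = (\<Sum>k<n. g k n x / 2 ^ Suc k)" for n x
  have "continuous_map X euclideanreal (h n)" for n
    unfolding h_def by (intro continuous_map_sum continuous_map_real_divide g) auto
  moreover have "(\<lambda>n. h n x) \<longlonglongrightarrow> y x" if x: "x \<in> topspace X" for x
  proof -
    \<comment> \<open>Extending the partial sum \<open>h n x\<close> by zeros makes it an infinite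
      series with terms dominated by \<open>(1 / 2) ^ k\<close>, so that Tannery's theorem
      interchanges limit and sum.\<close>
    define a where "a k n = (if k < n then g k n x / 2 ^ Suc k else 0)" for k n
    have "(\<lambda>n. a k n) \<longlonglongrightarrow> indicator (A k) x / 2 ^ Suc k" for k
    proof (rule Lim_transform_eventually)
      show "(\<lambda>n. g k n x / 2 ^ Suc k) \<longlonglongrightarrow> indicator (A k) x / 2 ^ Suc k"
        by (intro tendsto_divide g(3) x tendsto_const) simp
      show "\<forall>\<^sub>F n in sequentially. g k n x / 2 ^ Suc k = a k n"
        using eventually_gt_at_top[of k] by eventually_elim (simp add: a_def)
    qed
    moreover have "norm (a k n) \<le> (1 / 2) ^ k" for k n
      using g(2)[of k n x] by (auto simp: a_def power_divide divide_simps)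
    ultimately have "(\<lambda>n. \<Sum>k. a k n) \<longlonglongrightarrow> (\<Sum>k. indicator (A k) x / 2 ^ Suc k)"
      by (intro tannerys_theorem[where M = "\<lambda>k. (1 / 2) ^ k", THEN conjunct2, THEN conjunct2])
        (auto intro!: always_eventually summable_geometric)
    moreover have "(\<Sum>k. a k n) = h n x" for n
      unfolding h_def by (subst suminf_finite[of "{..<n}"]) (auto simp: a_def)
    moreover have "(\<Sum>k. indicator (A k) x / 2 ^ Suc k) = y x"
    proof -
      have "d k x \<in> {0, 1}" for k
        unfolding d_def by (rule binary_digit_cases)
      then have "indicator (A k) x = real_of_int (d k x)" for k
        using x by (cases "d k x = 1") (auto simp: A_def)
      then show ?thesis
        using binary_digits_sums[of "y x"] y[of x] by (simp add: d_def sums_iff)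
    qed
    ultimately show ?thesis
      by simp
  qed
  ultimately show ?thesis
    using that by blast
qed

text \<open>
  The homeomorphism \<open>t \<mapsto> t / (1 + \<bar>t\<bar>)\<close> of the line onto an open interval
  transports the claim to bounded functions; the factor \<open>1 - 1 / (n + 2)\<close> keeps the
  approximating functions away from the ends of that interval.
\<close>

lemma Baire_one_eq_if_bounded:
  assumes bdd: "\<And>f. f \<in> zero_outside (topspace X) \<Longrightarrow> (\<And>x. \<bar>f x\<bar> \<le> 1) \<Longrightarrow> f \<in> Baire_one X"
  shows "Baire_one X = zero_outside (topspace X)"
proof
  show "Baire_one X \<subseteq> zero_outside (topspace X)"
    by (auto simp: Baire_one_def)
  show "zero_outside (topspace X) \<subseteq> Baire_one X"
  proof
    fix f assume f: "f \<in> zero_outside (topspace X)"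
    define y where "y x = f x / (1 + \<bar>f x\<bar>)" for x
    have y: "\<bar>y x\<bar> < 1" "y x / (1 - \<bar>y x\<bar>) = f x" for x
      unfolding y_def by (auto simp: divide_simps abs_if)
    have "y \<in> Baire_one X"
      using f less_imp_le[OF y(1)] by (intro bdd) (auto simp: y_def zero_outside_def)
    then obtain g where g: "\<And>n. continuous_map X euclideanreal (g n)"
      "\<And>x. x \<in> topspace X \<Longrightarrow> (\<lambda>n. g n x) \<longlonglongrightarrow> y x"
      using Baire_oneE by blast
    \<comment> \<open>Clamping to \<open>[-1, 1]\<close> does not alter the limit, since
      \<open>\<bar>y x\<bar> < 1\<close>; the shift by 2 makes the factor start at
      \<open>1 / 2\<close>.\<close>
    define c where "c n x = (1 - 1 / real (n + 2)) * max (-1) (min 1 (g n x))" for n x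
    have c1: "\<bar>c n x\<bar> < 1" for n x
    proof -
      have "\<bar>c n x\<bar> \<le> (1 - 1 / real (n + 2)) * 1"
        unfolding c_def abs_mult by (intro mult_mono) auto
      also have "\<dots> < 1"
        by simp
      finally show ?thesis .
    qed
    have cont_c: "continuous_map X euclideanreal (c n)" for n
      unfolding c_def by (intro continuous_map_real_mult continuous_map_real_max
          continuous_map_real_min g) auto
    show "f \<in> Baire_one X"
    proof (rule Baire_oneI[OF f])
      show "continuous_map X euclideanreal (\<lambda>x. c n x / (1 - \<bar>c n x\<bar>))" for n
        using c1[of n] by (intro continuous_map_real_divide continuous_map_diff
            continuous_map_real_abs cont_c) (auto simp: less_le)
      fix x assume x: "x \<in> topspace X"
      have "(\<lambda>n. 1 - 1 / real (n + 2)) \<longlonglongrightarrow> 1 - 0"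
        by (intro tendsto_diff tendsto_const LIMSEQ_ignore_initial_segment[OF lim_1_over_n])
      then have "(\<lambda>n. c n x) \<longlonglongrightarrow> (1 - 0) * max (-1) (min 1 (y x))"
        unfolding c_def by (intro tendsto_mult tendsto_max tendsto_min tendsto_const g(2)[OF x])
      then have "(\<lambda>n. c n x) \<longlonglongrightarrow> y x"
        using y(1)[of x] by (simp add: max_def min_def abs_less_iff split: if_splits)
      then have "(\<lambda>n. c n x / (1 - \<bar>c n x\<bar>)) \<longlonglongrightarrow> y x / (1 - \<bar>y x\<bar>)"
        using y(1)[of x] by (intro tendsto_divide tendsto_diff tendsto_const tendsto_rabs) auto
      then show "(\<lambda>n. c n x / (1 - \<bar>c n x\<bar>)) \<longlonglongrightarrow> f x"
        by (simp add: y(2))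
    qed
  qed
qed

lemma Baire_one_eq_iff_Qf_space: "Baire_one X = zero_outside (topspace X) \<longleftrightarrow> Qf_space X"
proof
  assume eq: "Baire_one X = zero_outside (topspace X)"
  show "Qf_space X"
    unfolding Qf_space_iff_Zer_sigma
  proof (intro allI impI)
    fix A assume A: "A \<subseteq> topspace X"
    then have "indicator A \<in> Baire_one X"
      unfolding eq zero_outside_def by (auto simp: indicator_def)
    with A show "Zer_sigma_set X A"
      by (rule Zer_sigma_set_if_indicator_Baire_one)
  qed
next
  assume "Qf_space X"
  then have X: "\<And>A. A \<subseteq> topspace X \<Longrightarrow> Zer_sigma_set X A"
    by (simp add: Qf_space_iff_Zer_sigma)
  show "Baire_one X = zero_outside (topspace X)"
  proof (rule Baire_one_eq_if_bounded)
    fix f assume f: "f \<in> zero_outside (topspace X)" "\<And>x. \<bar>f x\<bar> \<le> 1"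
    \<comment> \<open>This affine map takes \<open>[-1, 1]\<close> to \<open>[0, 2 / 3]\<close>,
      safely inside the half-open interval where binary expansion applies.\<close>
    have "0 \<le> (f x + 1) / 3 \<and> (f x + 1) / 3 < 1" for x
      using f(2)[of x] by (simp add: abs_le_iff)
    then obtain g where g: "\<And>n. continuous_map X euclideanreal (g n)"
      "\<And>x. x \<in> topspace X \<Longrightarrow> (\<lambda>n. g n x) \<longlonglongrightarrow> (f x + 1) / 3"
      using unit_interval_function_limit_continuous[OF X, of "\<lambda>x. (f x + 1) / 3"] by blast
    show "f \<in> Baire_one X"
    proof (rule Baire_oneI[OF f(1)])
      show "continuous_map X euclideanreal (\<lambda>x. 3 * g n x - 1)" for n
        by (intro continuous_map_diff continuous_map_real_mult_left g) auto
      fix x assume x: "x \<in> topspace X"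
      have "(\<lambda>n. 3 * g n x - 1) \<longlonglongrightarrow> 3 * ((f x + 1) / 3) - 1"
        by (intro tendsto_diff tendsto_mult tendsto_const g(2)[OF x])
      moreover have "3 * ((f x + 1) / 3) - 1 = f x"
        by (simp add: field_simps)
      ultimately show "(\<lambda>n. 3 * g n x - 1) \<longlonglongrightarrow> f x"
        by metis
    qed
  qed
qed

section \<open>Interpolation on Tychonoff spaces and the equivalences\<close>

text \<open>Finite sets are closed, so complete regularity separates each \<open>x\<close> in
  \<open>F\<close> from the rest of \<open>F\<close> and gives functions \<open>u x\<close> that act
  as a Lagrange basis. Clamping their combination to \<open>[-1, 1]\<close> preserves the values on
  \<open>F\<close> because \<open>\<bar>f x\<bar> \<le> 1\<close>.\<close>

lemma Tychonoff_interpolate: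
  assumes X: "Tychonoff_space X" and F: "finite F" "F \<subseteq> topspace X"
    and f: "\<And>x. \<bar>f x\<bar> \<le> (1::real)"
  shows "\<exists>g\<in>cont_functions X. (\<forall>x\<in>F. g x = f x) \<and> (\<forall>x. \<bar>g x\<bar> \<le> 1)"
proof -
  have "\<exists>u. continuous_map X euclideanreal u \<and> (\<forall>y\<in>F. u y = (if y = x then 1 else 0))"
    if x: "x \<in> F" for x
  proof -
    have "closedin X (F - {x})"
      using X F unfolding Tychonoff_space_def by (intro closedin_Hausdorff_finite) auto
    then have cl: "closedin X (F - {x}) \<and> x \<in> topspace X - (F - {x})"
      using F(2) x by blast
    have "completely_regular_space X"
      using X by (simp add: Tychonoff_space_def)
    then obtain v :: "'a \<Rightarrow> real" where v: "continuous_map X (top_of_set {0..1}) v" "v x = 0"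
        "v ` (F - {x}) \<subseteq> {1}"
      using cl unfolding completely_regular_space_def by meson
    have "continuous_map X euclideanreal (\<lambda>y. 1 - v y)"
      using v(1) by (intro continuous_map_diff) (auto simp: continuous_map_in_subtopology)
    then show ?thesis
      using v(2,3) by (intro exI[of _ "\<lambda>y. 1 - v y"]) auto
  qed
  then obtain u where u: "\<And>x. x \<in> F \<Longrightarrow> continuous_map X euclideanreal (u x)"
      "\<And>x y. x \<in> F \<Longrightarrow> y \<in> F \<Longrightarrow> u x y = (if y = x then 1 else 0)"
    by metis
  define g where "g y = max (-1) (min 1 (\<Sum>x\<in>F. f x * u x y))" for y
  have "continuous_map X euclideanreal g"
    unfolding g_def
    by (intro continuous_map_real_max continuous_map_real_min continuous_map_sum
        continuous_map_real_mult_left u F) auto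
  moreover have "g y = f y" if y: "y \<in> F" for y
  proof -
    have "(\<Sum>x\<in>F. f x * u x y) = (\<Sum>x\<in>F. if x = y then f x else 0)"
      using u(2) y by (intro sum.cong) auto
    also have "\<dots> = f y"
      using F(1) y by simp
    finally show ?thesis
      using f[of y] by (auto simp: g_def)
  qed
  moreover have "\<bar>g y\<bar> \<le> 1" for y
    by (auto simp: g_def)
  ultimately show ?thesis
    using F(2)
    by (intro bexI[of _ "\<lambda>x. if x \<in> topspace X then g x else 0"] cont_functions_restrict) auto
qed

lemma cont_functions_subset_Baire_one: "cont_functions X \<subseteq> Baire_one X"
proof
  fix g assume "g \<in> cont_functions X"
  then show "g \<in> Baire_one X"
    by (intro Baire_oneI[where g = "\<lambda>_. g"]) (auto simp: cont_functions_def)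
qed

theorem theorem3p3:
  fixes X :: "'a topology"
  assumes "Tychonoff_space X"
  shows "(Montel (Baire_one_space X) \<longleftrightarrow> semi_Montel (Baire_one_space X)) \<and>
         (semi_Montel (Baire_one_space X) \<longleftrightarrow> reflexive (Baire_one_space X)) \<and>
         (reflexive (Baire_one_space X) \<longleftrightarrow> semi_reflexive (Baire_one_space X)) \<and>
         (semi_reflexive (Baire_one_space X) \<longleftrightarrow> complete_space (Baire_one_space X)) \<and>
         (complete_space (Baire_one_space X) \<longleftrightarrow> quasi_complete (Baire_one_space X)) \<and>
         (quasi_complete (Baire_one_space X) \<longleftrightarrow> Baire_one X = zero_outside (topspace X)) \<and>
         (Baire_one X = zero_outside (topspace X) \<longleftrightarrow> Qf_space X)"
proof -
  interpret interpolating_function_space "topspace X" "Baire_one X"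
  proof
    show "subspace (Baire_one X)"
      by (rule subspace_Baire_one)
    show "Baire_one X \<subseteq> zero_outside (topspace X)"
      by (auto simp: Baire_one_def)
    fix F and f :: "'a \<Rightarrow> real"
    assume "finite F" "F \<subseteq> topspace X" "\<And>x. \<bar>f x\<bar> \<le> 1"
    then show "\<exists>g\<in>Baire_one X. (\<forall>x\<in>F. g x = f x) \<and> (\<forall>x. \<bar>g x\<bar> \<le> 1)"
      using Tychonoff_interpolate[OF assms, of F f] cont_functions_subset_Baire_one by blast
  qed
  have T: "T = Baire_one_space X"
    by (simp add: T_def Baire_one_space_def)
  let ?full = "Baire_one X = zero_outside (topspace X)"
  \<comment> \<open>Each of the three weak properties puts the bounded functions into
    \<open>Baire_one X\<close>, and \<open>Baire_one_eq_if_bounded\<close> then covers the unbounded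
    ones.\<close>
  have "semi_Montel T \<Longrightarrow> ?full" "quasi_complete T \<Longrightarrow> ?full" "semi_reflexive T \<Longrightarrow> ?full"
    using Baire_one_eq_if_bounded semi_Montel_imp_mem quasi_complete_imp_mem semi_reflexive_imp_mem
    by blast+
  moreover have "semi_Montel T \<and> reflexive T \<and> complete_space T" if ?full
  proof -
    \<comment> \<open>Under \<open>?full\<close> the same \<open>T\<close> is the topology of the
      full power, so the strong properties return and the implications close into cycles.\<close>
    interpret full_function_space "topspace X" "Baire_one X"
      by standard (fact that)
    show ?thesis
      using semi_Montel_T reflexive_T complete_space_T by blast
  qed
  moreover have "reflexive T \<Longrightarrow> semi_reflexive T"
    unfolding reflexive_def semi_reflexive_def topological_isomorphism_def
    using homeomorphic_imp_surjective_map by blast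
  moreover have "complete_space T \<Longrightarrow> quasi_complete T"
    unfolding quasi_complete_def complete_space_def
    using complete_set_closedin closedin_subset by blast
  ultimately show ?thesis
    using Baire_one_eq_iff_Qf_space[of X] unfolding Montel_def T by blast
qed

end
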